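(* Let $\beta\in\mathbb{R}$, let $\Phi,\Psi$ be the one-variable functions (depending on $\beta$) defined in the context, with $\Phi\in\mathbb{L}_1\cap C^1(\mathrm{int}(\mathrm{dom}\,\Phi))$ and $\Psi\in\mathbb{L}_1\cap C^2(\mathrm{int}(\mathrm{dom}\,\Psi))$, let $b\in\mathcal{B}\subseteq\mathrm{dom}\,\Phi$, and let $\nabla\Psi(\theta)=\mathbf{E}[b]$. Consider the Bregman-beta divergence $d_\Phi(b;\theta)=\Phi(b)+\Psi(\theta)-\langle b,\theta\rangle$. Let $\sigma^2>0$ be a constant and $V(\mu)=\mu^{2-\beta}$. If $\beta\in[0,1]$ or $\beta\in(1,2]\cap\mathbb{R}_e$, then $$p_\Psi(b;\theta,\sigma^2)=\exp\!\left(-\frac{d_\Phi(b;\theta)}{\sigma^2}\right)p_0(b,\sigma^2)$$ is a log-concave density function with $\mathrm{dom}\,\Psi=\mathrm{int}(\mathrm{dom}\,\Psi)$ and $\nabla^2\Psi(\theta)=V(\nabla\Psi(\theta))\ge0$. Here $p_0(b,\sigma^2)$ is a base measure satisfying $\int_{\mathcal{B}}p_\Psi(b;\theta,\sigma^2)\,\nu(db)=1$. The corresponding regular $2$-LED model with power variance function $var(b)=\sigma^2\mu^{2-\beta}$ is $$p_\Psi(b;\theta,\sigma^2)=p_1(b,\sigma^2)\exp\!\left(\frac{\langle b,\theta\rangle-\Psi(\theta)}{\sigma^2}\right),\qquad p_1(b,\sigma^2)=p_0(b,\sigma^2)\exp(-\Phi(b)/\sigma^2).$$ Additionally, the domains of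 $\Phi$ and $\Psi$ are: - $1<\beta\le2$, $\beta\in\mathbb{R}_e$: $\mathrm{dom}\,\Phi=\mathbb{R}$, $\mathrm{dom}\,\Psi=\mathbb{R}$; - $\beta=1$: $\mathrm{dom}\,\Phi=\mathbb{R}_+$, $\mathrm{dom}\,\Psi=\mathbb{R}$; - $0<\beta<1$: $\mathrm{dom}\,\Phi=\mathbb{R}_+$, $\mathrm{dom}\,\Psi=\mathbb{R}_{--}$; - $0<\beta<1$, $\beta\in\mathbb{R}_e$: (alternatively) $\mathrm{dom}\,\Phi=\mathbb{R}_-$, $\mathrm{dom}\,\Psi=\mathbb{R}_{++}$; - $\beta=0$: $\mathrm{dom}\,\Phi=\mathbb{R}_{++}$, $\mathrm{dom}\,\Psi=\mathbb{R}_{--}$.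
   Context: Notation: $\mathbb{R}_+=\{x\ge0\}$, $\mathbb{R}_{++}=\{x>0\}$, $\mathbb{R}_-=\{x\le0\}$, $\mathbb{R}_{--}=\{x<0\}$; $\mathbb{R}_e=\{2k/(2l+1): k,l\in\mathbb{Z}\}$, $\mathbb{R}_o=\{(2k+1)/(2l+1): k,l\in\mathbb{Z}\}$. Real powers $x^r$ of negative $x$ are taken as real numbers when $r\in\mathbb{R}_e\cup\mathbb{R}_o$ (via odd roots). $\mathrm{dom} f=\{x : f(x)<+\infty\}$; int, cl, bd, conv denote interior, closure, boundary, convex hull. $\mathcal{B}\subseteq\mathbb{R}$ is the set of observations (values of the random variable $b$), $\mathbf{E}[b]$ their expectation, $\mu=\mathbf{E}[b]$. Legendre functions: $\mathbb{L}_n$ is the class of lower semicontinuous, convex, proper functions $f:\mathrm{dom} f\subseteq\mathbb{R}^n\to\mathbb{R}$ such that (i) $\mathrm{int}(\mathrm{dom} f)\neq\emptyset$ and $f\in C^1(\mathrm{int}(\mathrm{dom} f))$; (ii) $f$ is strictly convex on $\mathrm{int}(\mathrm{dom} f)$; (iii) (steepness) for all $x\in\mathrm{bd}(\mathrm{dom} f)$ and $y\in\mathrm{int}(\mathrm{dom} f)$, $\lim_{t\downarrow0}\langle\nabla f(x+t(y-x)),y-x\rangle=-\infty$. Base functions (additive constants are dropped, so $\Psi=\Phi^*$ up to constants): $\Phi(x)=-\log x$ if $\beta=0$; $\Phi(x)=x\log x-x$ if $\beta=1$; $\Phi(x)=\frac{1}{\beta(\beta-1)}x^\beta$ otherwise.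 $\Psi(x)=-\ln(-x)$ if $\beta=0$; $\Psi(x)=\exp(x)$ if $\beta=1$; $\Psi(x)=\frac1\beta[(\beta-1)x]^{\frac{\beta}{\beta-1}}$ otherwise. When two domains are listed for the same $\beta$, either branch may be chosen, consistently for $\Phi$ and $\Psi$. Log-concave density function: $g(x)=\exp(-f(x))$ with $f\in\mathbb{L}_n$ and $\int g(x)\,\nu(dx)=1$, where $\nu(dx)$ is an appropriate continuous Lebesgue (or discrete counting) measure. In the parameterized densities here, a base measure factor $p_0(b,\sigma^2)$, depending only on $b$ and $\sigma^2$, is used together with $\nu$ to normalize. K-LED (Legendre exponential dispersion model with $K$ cumulants, $K\ge1$): for $\psi\in\mathbb{L}_n\cap C^K(\mathrm{int}(\mathrm{dom}\,\psi))$ with $\nabla\psi(\theta)=\mathbf{E}[b]$, and (standing assumption) $\mathrm{int}(\mathrm{dom}\,\psi^* )=\mathrm{int}(B)$, $\mathcal{B}\subseteq\mathrm{dom}\,\psi^*\subseteq B$ with $B=\mathrm{cl}(\mathrm{conv}\,\mathcal{B})$, it is the density $p_\psi(b;\theta,\sigma^2)=\exp\left(\frac{\langle b,\theta\rangle-\psi(\theta)}{\sigma^2}\right)p_1(b,\sigma^2)$, where $\sigma^2>0$ is a dispersion parameter, $\mathrm{dom}\,\psi$ is the canonical parameter space, $\mathrm{dom}\,\psi^*$ is the mean parameter space, and $p_1(b,\sigma^2)$ is a base measure satisfying $\int_{\mathcal{B}}p_\psi(b;\theta,\sigma^2)\,\nu(db)=1$. The function $\sigma^{-2}(\psi(\theta+x\sigma^2)-\psi(\theta))$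 is its cumulant generating function up to the $K$-th cumulant (so for $K\ge2$, $var(b)=\sigma^2\nabla^2\psi(\theta)$). The model is regular if $\mathrm{dom}\,\psi$ is open. *)

theory Defs
  imports "HOL-Probability.Probability"
begin

section \<open>Real powers with rational exponents of odd denominator\<close>

definition R_even :: "real set" where
  "R_even = {2 * real_of_int k / (2 * real_of_int l + 1) | k l. True}"

definition R_odd :: "real set" where
  "R_odd = {(2 * real_of_int k + 1) / (2 * real_of_int l + 1) | k l. True}"

text \<open>
  \<open>rpow x r\<close> is the real power, taken through odd roots when the base is negative, and
  \<open>rpow_defined x r\<close> says that it is defined.  Unlike \<open>0 powr 0 = 0\<close>, we have \<open>rpow 0 0 = 1\<close>.
  Elsewhere the value of \<open>rpow\<close> is a dummy.
\<close>

definition rpow_defined :: "real \<Rightarrow> real \<Rightarrow> bool" where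
  "rpow_defined x r \<longleftrightarrow> 0 < x \<or> (x = 0 \<and> 0 \<le> r) \<or> (x < 0 \<and> r \<in> R_even \<union> R_odd)"

definition rpow :: "real \<Rightarrow> real \<Rightarrow> real" where
  "rpow x r =
     (if r = 0 then 1
      else if 0 \<le> x then x powr r
      else if r \<in> R_even then (- x) powr r
      else if r \<in> R_odd then - ((- x) powr r)
      else 0)"

section \<open>Extended-real-valued convex functions on the line\<close>

definition edom :: "(real \<Rightarrow> ereal) \<Rightarrow> real set" where
  "edom f = {x. f x < \<infinity>}"

definition fin :: "(real \<Rightarrow> ereal) \<Rightarrow> real \<Rightarrow> real" where
  "fin f x = real_of_ereal (f x)"

definition Ck_on :: "nat \<Rightarrow> (real \<Rightarrow> real) \<Rightarrow> real set \<Rightarrow> bool" where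
  "Ck_on k F S \<longleftrightarrow>
     (\<forall>j<k. \<forall>x\<in>S. ((deriv ^^ j) F has_real_derivative (deriv ^^ Suc j) F x) (at x)) \<and>
     continuous_on S ((deriv ^^ k) F)"

definition strictly_convex_on :: "real set \<Rightarrow> (real \<Rightarrow> real) \<Rightarrow> bool" where
  "strictly_convex_on S F \<longleftrightarrow>
     convex S \<and>
     (\<forall>x\<in>S. \<forall>y\<in>S. \<forall>t. x \<noteq> y \<and> 0 < t \<and> t < 1 \<longrightarrow>
        F ((1 - t) * x + t * y) < (1 - t) * F x + t * F y)"

definition legendre :: "(real \<Rightarrow> ereal) \<Rightarrow> bool" where
  "legendre f \<longleftrightarrow>
     (\<forall>x. f x \<le> Liminf (at x) f) \<and>
     (\<forall>x. f x \<noteq> -\<infinity>) \<and> edom f \<noteq> {} \<and>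
     convex_on (edom f) (fin f) \<and>
     interior (edom f) \<noteq> {} \<and> Ck_on 1 (fin f) (interior (edom f)) \<and>
     strictly_convex_on (interior (edom f)) (fin f) \<and>
     (\<forall>x\<in>frontier (edom f). \<forall>y\<in>interior (edom f).
        filterlim (\<lambda>t. deriv (fin f) (x + t * (y - x)) * (y - x)) at_bot (at_right 0))"

definition conjugate :: "(real \<Rightarrow> ereal) \<Rightarrow> real \<Rightarrow> ereal" where
  "conjugate f y = (SUP x. ereal (x * y) - f x)"

section \<open>The base functions of the beta divergence\<close>

definition Phi_defined :: "real \<Rightarrow> real \<Rightarrow> bool" where
  "Phi_defined \<beta> x \<longleftrightarrow>
     (if \<beta> = 0 then 0 < x else if \<beta> = 1 then 0 \<le> x else rpow_defined x \<beta>)"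

text \<open>For \<open>\<beta> = 1\<close> the convention \<open>0 log 0 = 0\<close> is built in, since \<open>0 * ln 0 = 0\<close>.\<close>

definition Phi_val :: "real \<Rightarrow> real \<Rightarrow> real" where
  "Phi_val \<beta> x =
     (if \<beta> = 0 then - ln x
      else if \<beta> = 1 then x * ln x - x
      else rpow x \<beta> / (\<beta> * (\<beta> - 1)))"

definition Psi_defined :: "real \<Rightarrow> real \<Rightarrow> bool" where
  "Psi_defined \<beta> x \<longleftrightarrow>
     (if \<beta> = 0 then x < 0 else if \<beta> = 1 then True
      else rpow_defined ((\<beta> - 1) * x) (\<beta> / (\<beta> - 1)))"

definition Psi_val :: "real \<Rightarrow> real \<Rightarrow> real" where
  "Psi_val \<beta> x =
     (if \<beta> = 0 then - ln (- x)
      else if \<beta> = 1 then exp x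
      else rpow ((\<beta> - 1) * x) (\<beta> / (\<beta> - 1)) / \<beta>)"

text \<open>
  The formulas do not determine the effective domains (for \<open>0 < \<beta> < 1\<close> with \<open>\<beta> \<in> R_even\<close>, the
  expression for \<open>\<Phi>\<close> makes sense on the whole line but is convex only on each half-line).  So
  \<open>\<Phi>\<close> and \<open>\<Psi>\<close> are functions that take the values of the formulas wherever they are finite, and
  that are conjugate to each other up to an additive constant (nonzero only for \<open>\<beta> = 0\<close>), which
  expresses that the branches are chosen consistently.  It is membership in the Legendre class that
  fixes the domains.
\<close>

definition base_functions :: "real \<Rightarrow> (real \<Rightarrow> ereal) \<Rightarrow> (real \<Rightarrow> ereal) \<Rightarrow> bool" where
  "base_functions \<beta> \<Phi> \<Psi> \<longleftrightarrow>
     (\<forall>x\<in>edom \<Phi>. Phi_defined \<beta> x \<and> \<Phi> x = ereal (Phi_val \<beta> x)) \<and>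
     (\<forall>x\<in>edom \<Psi>. Psi_defined \<beta> x \<and> \<Psi> x = ereal (Psi_val \<beta> x)) \<and>
     (\<exists>c::real. \<forall>x. conjugate \<Phi> x = \<Psi> x + ereal c)"

definition legendre_base_pair :: "real \<Rightarrow> (real \<Rightarrow> ereal) \<Rightarrow> (real \<Rightarrow> ereal) \<Rightarrow> bool" where
  "legendre_base_pair \<beta> \<Phi> \<Psi> \<longleftrightarrow>
     base_functions \<beta> \<Phi> \<Psi> \<and>
     legendre \<Phi> \<and> Ck_on 1 (fin \<Phi>) (interior (edom \<Phi>)) \<and>
     legendre \<Psi> \<and> Ck_on 2 (fin \<Psi>) (interior (edom \<Psi>))"

definition base_domains :: "real \<Rightarrow> (real set \<times> real set) set" where
  "base_domains \<beta> = {(D, E).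
     (1 < \<beta> \<and> \<beta> \<le> 2 \<and> \<beta> \<in> R_even \<and> D = UNIV \<and> E = UNIV) \<or>
     (\<beta> = 1 \<and> D = {0..} \<and> E = UNIV) \<or>
     (0 < \<beta> \<and> \<beta> < 1 \<and> D = {0..} \<and> E = {..<0}) \<or>
     (0 < \<beta> \<and> \<beta> < 1 \<and> \<beta> \<in> R_even \<and> D = {..0} \<and> E = {0<..}) \<or>
     (\<beta> = 0 \<and> D = {0<..} \<and> E = {..<0})}"

section \<open>Densities\<close>

definition is_pdf :: "real measure \<Rightarrow> real set \<Rightarrow> (real \<Rightarrow> real) \<Rightarrow> bool" where
  "is_pdf \<nu> B p \<longleftrightarrow>
     p \<in> borel_measurable (restrict_space \<nu> B) \<and> (\<forall>b\<in>B. 0 \<le> p b) \<and>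
     (\<integral>\<^sup>+b\<in>B. ennreal (p b) \<partial>\<nu>) = 1"

definition law :: "real measure \<Rightarrow> real set \<Rightarrow> (real \<Rightarrow> real) \<Rightarrow> real measure" where
  "law \<nu> B p = density (restrict_space \<nu> B) (\<lambda>b. ennreal (p b))"

text \<open>
  \<open>p = exp (- f)\<close> relative to the base factor \<open>h\<close>, which together with \<open>\<nu>\<close> forms the reference
  measure.
\<close>

definition log_concave_pdf ::
    "real measure \<Rightarrow> real set \<Rightarrow> (real \<Rightarrow> real) \<Rightarrow> (real \<Rightarrow> ereal) \<Rightarrow> (real \<Rightarrow> real) \<Rightarrow> bool" where
  "log_concave_pdf \<nu> B h f p \<longleftrightarrow>
     legendre f \<and> B \<subseteq> edom f \<and> (\<forall>b\<in>B. p b = exp (- fin f b) * h b) \<and> is_pdf \<nu> B p"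

definition bregman_beta :: "(real \<Rightarrow> ereal) \<Rightarrow> (real \<Rightarrow> ereal) \<Rightarrow> real \<Rightarrow> real \<Rightarrow> ereal" where
  "bregman_beta \<Phi> \<Psi> b \<theta> = \<Phi> b + \<Psi> \<theta> - ereal (b * \<theta>)"

definition bregman_pdf ::
    "(real \<Rightarrow> ereal) \<Rightarrow> (real \<Rightarrow> ereal) \<Rightarrow> (real \<Rightarrow> real \<Rightarrow> real) \<Rightarrow> real \<Rightarrow> real \<Rightarrow> real \<Rightarrow> real" where
  "bregman_pdf \<Phi> \<Psi> p0 \<theta> \<sigma>2 b = exp (- real_of_ereal (bregman_beta \<Phi> \<Psi> b \<theta>) / \<sigma>2) * p0 b \<sigma>2"

section \<open>Legendre exponential dispersion models\<close>

definition led_pdf ::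
    "(real \<Rightarrow> ereal) \<Rightarrow> (real \<Rightarrow> real \<Rightarrow> real) \<Rightarrow> real \<Rightarrow> real \<Rightarrow> real \<Rightarrow> real" where
  "led_pdf \<psi> p1 \<theta> \<sigma>2 b = p1 b \<sigma>2 * exp ((b * \<theta> - fin \<psi> \<theta>) / \<sigma>2)"

definition cgf :: "real measure \<Rightarrow> real \<Rightarrow> real" where
  "cgf P x = ln (\<integral>b. exp (x * b) \<partial>P)"

text \<open>
  \<open>\<psi>\<close> is required to give the mean and the first \<open>K\<close> cumulants at interior points of the canonical
  parameter space, where its derivatives exist.  The integrability conditions exclude the default
  value \<open>0\<close> of the Bochner integral.
\<close>

definition led_model ::
    "nat \<Rightarrow> (real \<Rightarrow> ereal) \<Rightarrow> real set \<Rightarrow> real measure \<Rightarrow> real \<Rightarrow> (real \<Rightarrow> real \<Rightarrow> real) \<Rightarrow> bool" where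
  "led_model K \<psi> B \<nu> \<sigma>2 p1 \<longleftrightarrow>
     1 \<le> K \<and> 0 < \<sigma>2 \<and>
     legendre \<psi> \<and> Ck_on K (fin \<psi>) (interior (edom \<psi>)) \<and>
     interior (edom (conjugate \<psi>)) = interior (closure (convex hull B)) \<and>
     B \<subseteq> edom (conjugate \<psi>) \<and> edom (conjugate \<psi>) \<subseteq> closure (convex hull B) \<and>
     (\<forall>\<theta>\<in>edom \<psi>. is_pdf \<nu> B (led_pdf \<psi> p1 \<theta> \<sigma>2)) \<and>
     (\<forall>\<theta>\<in>interior (edom \<psi>). let P = law \<nu> B (led_pdf \<psi> p1 \<theta> \<sigma>2) in
        integrable P (\<lambda>b. b) \<and>
        prob_space.expectation P (\<lambda>b. b) = deriv (fin \<psi>) \<theta> \<and>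
        (\<forall>\<^sub>F x in nhds 0. integrable P (\<lambda>b. exp (x * b))) \<and>
        (\<forall>j\<in>{1..K}. (deriv ^^ j) (cgf P) 0 =
           (deriv ^^ j) (\<lambda>x. (fin \<psi> (\<theta> + x * \<sigma>2) - fin \<psi> \<theta>) / \<sigma>2) 0))"

definition regular_led_model ::
    "nat \<Rightarrow> (real \<Rightarrow> ereal) \<Rightarrow> real set \<Rightarrow> real measure \<Rightarrow> real \<Rightarrow> (real \<Rightarrow> real \<Rightarrow> real) \<Rightarrow> bool" where
  "regular_led_model K \<psi> B \<nu> \<sigma>2 p1 \<longleftrightarrow> led_model K \<psi> B \<nu> \<sigma>2 p1 \<and> open (edom \<psi>)"

end

theory Submission
  imports Defs
begin

text \<open>
  On each admissible domain the formulas for \<open>\<Phi>\<close> and \<open>\<Psi>\<close> have strictly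
  increasing gradients that are inverse to each other.  A function with strictly increasing
  derivative is strictly convex, and its conjugate at the slope of a tangent is read off from that
  tangent; therefore \<open>\<Phi>\<^sup>* = \<Psi>\<close> up to a constant.  Both functions are Legendre, because the
  only boundary point is \<open>0\<close> and a gradient that is onto a set unbounded in the right direction is
  steep there (\<open>legendre_Phi_base\<close>, \<open>legendre_Psi_base\<close>, \<open>conjugate_Phi_base\<close>).

  Conversely, a Legendre function given by the formula for \<open>\<Phi>\<close> can only live on the listed domains:
  steepness forbids a boundary point at which the formula is continuously differentiable, lower
  semicontinuity decides whether \<open>0\<close> belongs to the domain, and strict convexity selects the branch
  (\<open>legendre_Phi_domain\<close>).  The domain of \<open>\<Psi>\<close> is then that of \<open>\<Phi>\<^sup>*\<close>.  The variance
  function comes from differentiating \<open>\<nabla>\<Psi>\<close>, which is \<open>[(\<beta> - 1) y] powr (1 / (\<beta> - 1))\<close> for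
  \<open>\<beta> \<noteq> 1\<close>: its derivative is \<open>(\<nabla>\<Psi>) powr (2 - \<beta>)\<close>.

  For the dispersion model, normalization for all \<open>\<theta>\<close> in the open domain of \<open>\<Psi>\<close> determines the
  moment generating function as a quotient of normalizing constants, hence the cumulants.  The
  first two moments are derivatives of the generating function at \<open>0\<close> (\<open>moments_of_mgf\<close>).  Finally
  the condition that relates the mean parameter space to the observations follows from the means:
  every \<open>\<nabla>\<Psi>(\<theta>)\<close> lies in the convex hull of the observations, and these means fill the interior
  of the domain of \<open>\<Phi>\<close> (\<open>mean_in_convex_hull\<close>, \<open>grad_Psi_image\<close>).
\<close>

section \<open>Powers with exponents of odd denominator\<close>

lemma R_even_conjugate_exponent:
  assumes "\<beta> \<in> R_even"
  shows "\<beta> / (\<beta> - 1) \<in> R_even"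
proof -
  obtain k l :: int where b: "\<beta> = 2 * real_of_int k / (2 * real_of_int l + 1)"
    using assms by (auto simp: R_even_def)
  have nz: "2 * real_of_int l + 1 \<noteq> 0"
    using of_int_eq_0_iff[of "2 * l + 1", where ?'a = real] by (simp; presburger)
  have "\<beta> - 1 = (2 * real_of_int k - (2 * real_of_int l + 1)) / (2 * real_of_int l + 1)"
    using nz by (simp add: b field_simps)
  then have "\<beta> / (\<beta> - 1) = 2 * real_of_int k / (2 * real_of_int (k - l - 1) + 1)"
    using nz by (simp add: b)
  then show ?thesis
    unfolding R_even_def by blast
qed

lemma R_even_two_minus:
  assumes "\<beta> \<in> R_even"
  shows "2 - \<beta> \<in> R_even"
proof -
  obtain k l :: int where b: "\<beta> = 2 * real_of_int k / (2 * real_of_int l + 1)"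
    using assms by (auto simp: R_even_def)
  have nz: "2 * real_of_int l + 1 \<noteq> 0"
    using of_int_eq_0_iff[of "2 * l + 1", where ?'a = real] by (simp; presburger)
  have "2 - \<beta> = 2 * real_of_int (2 * l + 1 - k) / (2 * real_of_int l + 1)"
    using nz by (simp add: b field_simps)
  then show ?thesis
    unfolding R_even_def by blast
qed

lemma rpow_eq_abs_powr:
  assumes "r \<noteq> 0" "0 \<le> x \<or> r \<in> R_even"
  shows "rpow x r = \<bar>x\<bar> powr r"
  using assms by (auto simp: rpow_def)

section \<open>Smooth strictly convex functions on an interval\<close>

definition extend :: "real set \<Rightarrow> (real \<Rightarrow> real) \<Rightarrow> real \<Rightarrow> ereal" where
  "extend D F x = (if x \<in> D then ereal (F x) else \<infinity>)"

lemma edom_extend [simp]: "edom (extend D F) = D"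
  by (auto simp: edom_def extend_def)

lemma fin_extend: "x \<in> D \<Longrightarrow> fin (extend D F) x = F x"
  by (simp add: fin_def extend_def)

lemma deriv_eq_on_open:
  assumes "open S" "x \<in> S" "\<And>y. y \<in> S \<Longrightarrow> f y = F y"
    and "(F has_real_derivative d) (at x)"
  shows "(f has_real_derivative d) (at x)"
  using has_field_derivative_transform_within_open[OF assms(4,1,2)] assms(3) by auto

lemma Ck_on_1I:
  assumes "open S" "\<And>x. x \<in> S \<Longrightarrow> (F has_real_derivative p x) (at x)" "continuous_on S p"
  shows "Ck_on 1 F S"
proof -
  have d: "deriv F x = p x" if "x \<in> S" for x
    using assms(2)[OF that] by (rule DERIV_imp_deriv)
  have "continuous_on S (deriv F)"
    using assms(3) d by (simp cong: continuous_on_cong)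
  then show ?thesis
    using assms(2) d by (simp add: Ck_on_def)
qed

lemma Ck_on_2I:
  assumes "open S" "\<And>x. x \<in> S \<Longrightarrow> (F has_real_derivative p x) (at x)"
    and "\<And>x. x \<in> S \<Longrightarrow> (p has_real_derivative p' x) (at x)" "continuous_on S p'"
  shows "Ck_on 2 F S"
proof -
  have d: "deriv F x = p x" if "x \<in> S" for x
    using assms(2)[OF that] by (rule DERIV_imp_deriv)
  have d': "(deriv F has_real_derivative p' x) (at x)" if "x \<in> S" for x
    using assms(1) that d assms(3)[OF that] by (rule deriv_eq_on_open)
  have d2: "deriv (deriv F) x = p' x" if "x \<in> S" for x
    using d'[OF that] by (rule DERIV_imp_deriv)
  have "continuous_on S (deriv (deriv F))"
    using assms(4) d2 by (simp cong: continuous_on_cong)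
  then show ?thesis
    using assms(2) d d' d2 by (auto simp: Ck_on_def less_Suc_eq numeral_2_eq_2)
qed

text \<open>
  Differentiability is confined to the interior: at an endpoint that belongs to \<open>D\<close>, such as \<open>0\<close>
  for \<open>\<Phi>\<close> when \<open>0 < \<beta> \<le> 1\<close>, the slope is infinite and only continuity is left.
\<close>

locale smooth_convex =
  fixes D :: "real set" and F p :: "real \<Rightarrow> real"
  assumes convex: "convex D"
    and interior_nonempty: "interior D \<noteq> {}"
    and cont: "continuous_on D F"
    and deriv: "x \<in> interior D \<Longrightarrow> (F has_real_derivative p x) (at x)"
    and strict_mono: "strict_mono_on (interior D) p"
    and cont_deriv: "continuous_on (interior D) p"
begin

lemma between_interior:
  assumes "x \<in> D" "y \<in> D" "x < z" "z < y"
  shows "z \<in> interior D"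
proof -
  have "{x<..<y} \<subseteq> D"
    using convex assms(1,2) by (fastforce simp: convex_contains_segment closed_segment_eq_real_ivl)
  then show ?thesis
    using assms(3,4) interior_maximal[of "{x<..<y}" D] by auto
qed

lemma strict_tangent:
  assumes z: "z \<in> interior D" and x: "x \<in> D" and "x \<noteq> z"
  shows "F z + p z * (x - z) < F x"
proof -
  have zD: "z \<in> D"
    using z interior_subset by auto
  have cI: "continuous_on {a..b} F" if "a \<in> D" "b \<in> D" for a b
    using convex that
    by (intro continuous_on_subset[OF cont])
       (fastforce simp: convex_contains_segment closed_segment_eq_real_ivl)
  consider "x < z" | "z < x"
    using \<open>x \<noteq> z\<close> by linarith
  then show ?thesis
  proof cases
    case 1
    obtain l w where w: "x < w" "w < z" "(F has_real_derivative l) (at w)"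
      "F z - F x = (z - x) * l"
      using MVT[OF 1 cI[OF x zD]] between_interior[OF x zD] deriv real_differentiable_def by metis
    have wI: "w \<in> interior D"
      using between_interior[OF x zD w(1,2)] .
    have "l = p w"
      using DERIV_unique[OF w(3) deriv[OF wI]] .
    also have "\<dots> < p z"
      using strict_mono_onD[OF strict_mono wI z w(2)] .
    finally show ?thesis
      using 1 w(4) mult_strict_left_mono[of l "p z" "z - x"] by (simp add: algebra_simps)
  next
    case 2
    obtain l w where w: "z < w" "w < x" "(F has_real_derivative l) (at w)"
      "F x - F z = (x - z) * l"
      using MVT[OF 2 cI[OF zD x]] between_interior[OF zD x] deriv real_differentiable_def by metis
    have wI: "w \<in> interior D"
      using between_interior[OF zD x w(1,2)] .
    have "l = p w"
      using DERIV_unique[OF w(3) deriv[OF wI]] .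
    also have "\<dots> > p z"
      using strict_mono_onD[OF strict_mono z wI w(1)] .
    finally show ?thesis
      using 2 w(4) mult_strict_left_mono[of "p z" l "x - z"] by (simp add: algebra_simps)
  qed
qed

text \<open>
  A point strictly between two points of \<open>D\<close> is interior, so it has a tangent, and that tangent
  lies strictly below both endpoint values even when these are attained on the boundary.
\<close>

lemma strictly_convex: "strictly_convex_on D F"
  unfolding strictly_convex_on_def
proof (intro conjI ballI allI impI convex)
  fix x y t :: real
  assume xy: "x \<in> D" "y \<in> D" and t: "x \<noteq> y \<and> 0 < t \<and> t < 1"
  define z where "z = (1 - t) * x + t * y"
  have "z - x = t * (y - x)" "y - z = (1 - t) * (y - x)"
    by (auto simp: z_def algebra_simps)
  then have ord: "x < z \<and> z < y \<or> y < z \<and> z < x"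
    using t mult_pos_pos[of t "y - x"] mult_pos_pos[of "1 - t" "y - x"]
      mult_pos_neg[of t "y - x"] mult_pos_neg[of "1 - t" "y - x"] by linarith
  then have zI: "z \<in> interior D"
    using between_interior xy by blast
  have "(1 - t) * (F z + p z * (x - z)) < (1 - t) * F x" "t * (F z + p z * (y - z)) < t * F y"
    using strict_tangent[OF zI] xy ord t by (auto intro!: mult_strict_left_mono)
  moreover have "(1 - t) * (F z + p z * (x - z)) + t * (F z + p z * (y - z)) = F z"
    by (simp add: z_def algebra_simps)
  ultimately show "F ((1 - t) * x + t * y) < (1 - t) * F x + t * F y"
    unfolding z_def[symmetric] by linarith
qed

lemma has_real_derivative_fin_extend:
  assumes "x \<in> interior D"
  shows "(fin (extend D F) has_real_derivative p x) (at x)"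
  using interior_subset[of D]
  by (intro deriv_eq_on_open[OF _ assms _ deriv[OF assms]]) (auto simp: fin_extend)

lemma steep_extend_iff:
  assumes x: "x \<in> frontier D" and y: "y \<in> interior D"
  shows "filterlim (\<lambda>t. deriv (fin (extend D F)) (x + t * (y - x)) * (y - x)) at_bot (at_right 0)
    \<longleftrightarrow> filterlim (\<lambda>t. p (x + t * (y - x)) * (y - x)) at_bot (at_right 0)"
proof (rule filterlim_cong[OF refl refl])
  have "deriv (fin (extend D F)) (x + t * (y - x)) * (y - x) = p (x + t * (y - x)) * (y - x)"
    if t: "0 < t" "t < 1" for t
  proof -
    have "x - t *\<^sub>R (x - y) \<in> interior D"
      using x t by (intro mem_interior_closure_convex_shrink[OF convex y]) (auto simp: frontier_def)
    then have "x + t * (y - x) \<in> interior D"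
      by (simp add: algebra_simps)
    then show ?thesis
      using has_real_derivative_fin_extend by (simp add: DERIV_imp_deriv)
  qed
  then show "\<forall>\<^sub>F t in at_right 0. deriv (fin (extend D F)) (x + t * (y - x)) * (y - x)
      = p (x + t * (y - x)) * (y - x)"
    by (auto simp: eventually_at_right_field intro!: exI[of _ 1])
qed

lemma Ck_on_1_extend: "Ck_on 1 (fin (extend D F)) (interior D)"
  by (rule Ck_on_1I[where p = p]) (simp_all add: cont_deriv has_real_derivative_fin_extend)

lemma lower_semicontinuous_extend:
  assumes "\<And>x. x \<in> frontier D - D \<Longrightarrow> filterlim F at_top (at x within D)"
  shows "extend D F x \<le> Liminf (at x) (extend D F)"
  unfolding le_Liminf_iff
proof (intro allI impI)
  fix a assume a: "a < extend D F x"
  consider "x \<in> D" | "x \<notin> closure D" | "x \<in> frontier D - D"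
    using interior_subset by (auto simp: frontier_def)
  then have "\<forall>\<^sub>F y in at x within D. a < ereal (F y)"
  proof cases
    case 1
    then have "((\<lambda>y. ereal (F y)) \<longlongrightarrow> ereal (F x)) (at x within D)"
      using cont by (simp add: continuous_on_def)
    from order_tendstoD(1)[OF this, of a] show ?thesis
      using 1 a by (simp add: extend_def)
  next
    case 2
    then have "at x within D = bot"
      by (simp add: trivial_limit_within not_in_closure_trivial_limitI)
    then show ?thesis
      by simp
  next
    case 3
    then have "a \<noteq> \<infinity>"
      using a by auto
    then obtain r where r: "a \<le> ereal r"
      by (cases a) auto
    have "\<forall>\<^sub>F y in at x within D. r < F y"
      using assms[OF 3] by (simp add: filterlim_at_top_dense)
    then show ?thesis
      by eventually_elim (use r in \<open>auto intro: le_less_trans\<close>)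
  qed
  then show "\<forall>\<^sub>F y in at x. a < extend D F y"
    using a unfolding eventually_at_filter
    by (auto elim!: eventually_mono simp: extend_def less_top[symmetric] split: if_splits)
qed

lemma legendre_extend:
  assumes barrier: "\<And>x. x \<in> frontier D - D \<Longrightarrow> filterlim F at_top (at x within D)"
    and steep: "\<And>x y. x \<in> frontier D \<Longrightarrow> y \<in> interior D \<Longrightarrow>
      filterlim (\<lambda>t. p (x + t * (y - x)) * (y - x)) at_bot (at_right 0)"
  shows "legendre (extend D F)"
proof -
  have sc: "strictly_convex_on D (fin (extend D F))"
    using strictly_convex convexD_alt[OF convex]
    by (simp add: strictly_convex_on_def fin_extend)
  have co: "convex_on D (fin (extend D F))"
  proof (rule convex_onI[OF _ convex])
    fix t x y :: real
    assume "0 < t" "t < 1" "x \<in> D" "y \<in> D"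
    then have "x \<noteq> y \<Longrightarrow> fin (extend D F) ((1 - t) * x + t * y)
        < (1 - t) * fin (extend D F) x + t * fin (extend D F) y"
      using sc by (simp add: strictly_convex_on_def)
    moreover have "(1 - t) * x + t * x = x" for x :: real
      by (simp add: algebra_simps)
    ultimately show "fin (extend D F) ((1 - t) *\<^sub>R x + t *\<^sub>R y)
        \<le> (1 - t) * fin (extend D F) x + t * fin (extend D F) y"
      by (cases "x = y") auto
  qed
  have sci: "strictly_convex_on (interior D) (fin (extend D F))"
    using sc convex_interior[OF convex] interior_subset[of D]
    unfolding strictly_convex_on_def by blast
  have steep': "filterlim (\<lambda>t. deriv (fin (extend D F)) (x + t * (y - x)) * (y - x)) at_bot (at_right 0)"
    if "x \<in> frontier D" "y \<in> interior D" for x y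
    using steep[OF that] steep_extend_iff[OF that] by blast
  have "extend D F x \<noteq> - \<infinity>" for x
    by (simp add: extend_def)
  moreover have "D \<noteq> {}"
    using interior_nonempty interior_subset[of D] by auto
  ultimately show ?thesis
    unfolding legendre_def edom_extend
    using lower_semicontinuous_extend[OF barrier] co interior_nonempty Ck_on_1_extend sci steep'
    by blast
qed

lemma legendre_extend_UNIV: "D = UNIV \<Longrightarrow> legendre (extend D F)"
  by (rule legendre_extend) auto

text \<open>
  On a half-line with endpoint \<open>0\<close>, the monotone derivative \<open>p\<close> tends to its infimum towards the
  endpoint; steepness thus means that \<open>p\<close> is unbounded below (above, for a left half-line).
\<close>

lemma legendre_extend_halfline:
  assumes s: "\<bar>s\<bar> = 1" and I: "interior D = {x. 0 < s * x}" "D \<subseteq> {x. 0 \<le> s * x}"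
    and unbounded: "\<And>K. \<exists>x. 0 < s * x \<and> s * p x < K"
    and barrier: "0 \<notin> D \<Longrightarrow> filterlim F at_top (at 0 within D)"
  shows "legendre (extend D F)"
proof -
  have s': "s = 1 \<or> s = -1"
    using s by linarith
  have fr: "x = 0" if "x \<in> frontier D" for x
  proof -
    have "closed {x. 0 \<le> s * x}"
      by (intro closed_Collect_le continuous_intros)
    then have "closure D \<subseteq> {x. 0 \<le> s * x}"
      using I(2) by (rule closure_minimal[rotated])
    then show ?thesis
      using that I(1) s' by (auto simp: frontier_def)
  qed
  show ?thesis
  proof (rule legendre_extend)
    fix x assume "x \<in> frontier D - D"
    then show "filterlim F at_top (at x within D)"
      using fr[of x] barrier by auto
  next
    fix x y assume x: "x \<in> frontier D" and y: "y \<in> interior D"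
    have "0 < s * y"
      using y I(1) by auto
    show "filterlim (\<lambda>t. p (x + t * (y - x)) * (y - x)) at_bot (at_right 0)"
      unfolding filterlim_at_bot_dense
    proof
      fix K :: real
      obtain w where w: "0 < s * w" "s * p w < K / (s * y)"
        using unbounded by blast
      have "p (x + t * (y - x)) * (y - x) < K" if t: "0 < t" "t < w / y" for t
      proof -
        have ty: "0 < s * (t * y)" "s * (t * y) < s * w"
          using t s' \<open>0 < s * y\<close> w(1) by (auto simp: field_simps mult_less_0_iff zero_less_mult_iff)
        have "s * p (t * y) < s * p w"
        proof (cases "s = 1")
          case True
          then show ?thesis
            using strict_mono_onD[OF strict_mono, of "t * y" w] I(1) ty w(1) by auto
        next
          case False
          then show ?thesis
            using strict_mono_onD[OF strict_mono, of w "t * y"] I(1) ty w(1) s' by auto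
        qed
        then have "s * p (t * y) < K / (s * y)"
          using w(2) by simp
        then have "s * p (t * y) * (s * y) < K"
          using \<open>0 < s * y\<close> by (simp add: pos_less_divide_eq)
        then show ?thesis
          using fr[OF x] s' by auto
      qed
      moreover have "0 < w / y"
        using w(1) \<open>0 < s * y\<close> s' by (auto simp: divide_neg_neg)
      ultimately show "\<forall>\<^sub>F t in at_right 0. p (x + t * (y - x)) * (y - x) < K"
        by (auto simp: eventually_at_right_field)
    qed
  qed
qed

text \<open>
  Adding an affine function and rescaling shifts the gradient by a constant, which is negligible
  against its divergence at the boundary.  This passes from \<open>\<Phi>\<close> to the Bregman divergence.
\<close>

lemma legendre_extend_tilt:
  assumes leg: "legendre (extend D F)" and "0 < s"
  shows "legendre (extend D (\<lambda>x. (F x + k - x * \<theta>) / s))"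
proof -
  have "p x / s - \<theta> / s < p y / s - \<theta> / s" if "p x < p y" for x y
    using that \<open>0 < s\<close> by (simp add: divide_strict_right_mono)
  then have sm: "strict_mono_on (interior D) (\<lambda>x. p x / s - \<theta> / s)"
    using strict_mono by (auto simp: strict_mono_on_def)
  interpret tilt: smooth_convex D "\<lambda>x. (F x + k - x * \<theta>) / s" "\<lambda>x. p x / s - \<theta> / s"
  proof
    fix x assume "x \<in> interior D"
    from deriv[OF this]
    show "((\<lambda>x. (F x + k - x * \<theta>) / s) has_real_derivative p x / s - \<theta> / s) (at x)"
      using \<open>0 < s\<close> by (auto intro!: derivative_eq_intros simp: field_simps)
  qed (use \<open>0 < s\<close> convex interior_nonempty sm in
      \<open>auto intro!: continuous_intros cont cont_deriv\<close>)
  show ?thesis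
  proof (rule tilt.legendre_extend)
    fix x assume x: "x \<in> frontier D - D"
    have "filterlim F at_top (at x within D)"
      unfolding filterlim_at_top_dense
    proof
      fix K
      have "extend D F x \<le> Liminf (at x) (extend D F)"
        using leg by (simp add: legendre_def)
      then have "ereal K < Liminf (at x) (extend D F)"
        using x by (simp add: extend_def)
      then have "\<forall>\<^sub>F y in at x. ereal K < extend D F y"
        by (rule less_LiminfD)
      then show "\<forall>\<^sub>F y in at x within D. K < F y"
        by (auto simp: eventually_at_filter extend_def elim: eventually_mono)
    qed
    moreover have "((\<lambda>y. k - y * \<theta>) \<longlongrightarrow> k - x * \<theta>) (at x within D)"
      by (intro tendsto_intros)
    ultimately have "filterlim (\<lambda>y. (k - y * \<theta>) + F y) at_top (at x within D)"
      by (rule filterlim_tendsto_add_at_top[rotated])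
    from filterlim_tendsto_pos_mult_at_top[OF tendsto_const _ this, of "inverse s"]
    show "filterlim (\<lambda>y. (F y + k - y * \<theta>) / s) at_top (at x within D)"
      using \<open>0 < s\<close> by (simp add: divide_inverse algebra_simps)
  next
    fix x y assume xy: "x \<in> frontier D" "y \<in> interior D"
    have "filterlim (\<lambda>t. p (x + t * (y - x)) * (y - x)) at_bot (at_right 0)"
      using leg xy steep_extend_iff[OF xy] by (simp add: legendre_def)
    from filterlim_tendsto_add_at_top[OF tendsto_const[of "\<theta> / s * (y - x)"]
        filterlim_tendsto_pos_mult_at_top[OF tendsto_const[of "inverse s"] _
          this[unfolded filterlim_uminus_at_bot]]]
    show "filterlim (\<lambda>t. (p (x + t * (y - x)) / s - \<theta> / s) * (y - x)) at_bot (at_right 0)"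
      using \<open>0 < s\<close> unfolding filterlim_uminus_at_bot by (simp add: divide_inverse algebra_simps)
  qed
qed

text \<open>The tangent at \<open>x\<close> is the affine minorant of slope \<open>p x\<close>, and it touches at \<open>x\<close>.\<close>

lemma conjugate_extend:
  assumes "x \<in> interior D"
  shows "conjugate (extend D F) (p x) = ereal (x * p x - F x)"
proof (rule antisym)
  show "conjugate (extend D F) (p x) \<le> ereal (x * p x - F x)"
    unfolding conjugate_def
  proof (rule SUP_least)
    fix u
    show "ereal (u * p x) - extend D F u \<le> ereal (x * p x - F x)"
    proof (cases "u \<in> D \<and> u \<noteq> x")
      case True
      then show ?thesis
        using strict_tangent[OF assms, of u] by (simp add: extend_def algebra_simps)
    next
      case False
      then show ?thesis
        using assms interior_subset by (auto simp: extend_def)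
    qed
  qed
  show "ereal (x * p x - F x) \<le> conjugate (extend D F) (p x)"
    unfolding conjugate_def
    using assms interior_subset by (intro SUP_upper2[of x]) (auto simp: extend_def)
qed

end

lemma conjugate_extend_infinite:
  assumes "filterlim (\<lambda>t. x t * y - F (x t)) at_top G" "\<forall>\<^sub>F t in G. x t \<in> D" "G \<noteq> bot"
  shows "conjugate (extend D F) y = \<infinity>"
proof (rule ereal_top)
  fix K :: real
  have "\<forall>\<^sub>F t in G. K \<le> x t * y - F (x t)"
    using assms(1) by (simp add: filterlim_at_top)
  then have "\<forall>\<^sub>F t in G. x t \<in> D \<and> K \<le> x t * y - F (x t)"
    using assms(2) by eventually_elim auto
  then obtain t where "x t \<in> D" "K \<le> x t * y - F (x t)"
    using eventually_happens'[OF assms(3)] by blast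
  then show "ereal K \<le> conjugate (extend D F) y"
    unfolding conjugate_def by (intro SUP_upper2[of "x t"]) (auto simp: extend_def)
qed

text \<open>
  Mutually inverse gradients: monotonicity need only be checked on one side, and continuity of both
  gradients is automatic, since a monotone function with open range is continuous.
\<close>

lemma inverse_gradients_smooth_convex:
  assumes D: "convex D" "interior D \<noteq> {}" and E: "convex E" "open E"
    and p: "strict_mono_on (interior D) p" "\<And>x. x \<in> interior D \<Longrightarrow> p x \<in> E"
    and q: "\<And>y. y \<in> E \<Longrightarrow> q y \<in> interior D" "\<And>y. y \<in> E \<Longrightarrow> p (q y) = y"
    and F: "continuous_on D F" "\<And>x. x \<in> interior D \<Longrightarrow> (F has_real_derivative p x) (at x)"
    and G: "\<And>y. y \<in> E \<Longrightarrow> (G has_real_derivative q y) (at y)"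
  shows "smooth_convex D F p" "smooth_convex E G q" "p ` interior D = E" "q ` E = interior D"
proof -
  have inj: "inj_on p (interior D)"
    using p(1) by (rule strict_mono_on_imp_inj_on)
  show pi: "p ` interior D = E"
  proof
    show "E \<subseteq> p ` interior D"
      using q by (metis image_eqI subsetI)
  qed (use p(2) in auto)
  have qp: "q (p x) = x" if "x \<in> interior D" for x
    using inj that p(2) q by (auto dest: inj_onD)
  show qi: "q ` E = interior D"
  proof
    show "interior D \<subseteq> q ` E"
      using qp p(2) by (metis image_eqI subsetI)
  qed (use q(1) in auto)
  have qm: "strict_mono_on E q"
  proof (rule strict_mono_onI)
    fix y z assume yz: "y \<in> E" "z \<in> E" "y < z"
    show "q y < q z"
    proof (rule ccontr)
      assume "\<not> q y < q z"
      then have "p (q z) \<le> p (q y)"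
        using strict_mono_onD[OF p(1), of "q z" "q y"] q(1) yz by (cases "q z = q y") auto
      then show False
        using yz q(2) by auto
    qed
  qed
  have pc: "continuous_on (interior D) p"
    using pi E(2) p(1) by (intro continuous_onI_mono) (auto dest: strict_mono_onD simp: le_less)
  have qc: "continuous_on E q"
    using qi qm by (intro continuous_onI_mono) (auto dest: strict_mono_onD simp: le_less)
  show "smooth_convex D F p"
    using D p(1) F pc by unfold_locales auto
  have "E \<noteq> {}"
    using D(2) pi by auto
  moreover have "continuous_on E G"
    using G by (meson DERIV_isCont continuous_at_imp_continuous_on)
  ultimately show "smooth_convex E G q"
    using E qm G qc by unfold_locales (simp_all add: interior_open)
qed

section \<open>Effective domains of Legendre functions\<close>

text \<open>
  Steepness excludes a boundary point at which the formula for the function is continuously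
  differentiable, since there the directional derivatives stay bounded.
\<close>

lemma legendre_not_frontier:
  assumes f: "legendre f" and F: "\<And>x. x \<in> edom f \<Longrightarrow> f x = ereal (F x)"
    and S: "open S" "x \<in> S" "\<And>u. u \<in> S \<Longrightarrow> (F has_real_derivative p u) (at u)" "continuous_on S p"
  shows "x \<notin> frontier (edom f)"
proof
  assume x: "x \<in> frontier (edom f)"
  have cD: "convex (edom f)"
    using f by (auto simp: legendre_def convex_on_def)
  obtain y where y: "y \<in> interior (edom f)"
    using f by (auto simp: legendre_def)
  let ?u = "\<lambda>t. x + t * (y - x)"
  have u: "(?u \<longlongrightarrow> x) (at_right 0)"
    by (auto intro!: tendsto_eq_intros)
  have lim: "((\<lambda>t. p (?u t) * (y - x)) \<longlongrightarrow> p x * (y - x)) (at_right 0)"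
    using S by (intro tendsto_intros isCont_tendsto_compose[OF _ u])
      (auto simp: continuous_on_eq_continuous_at)
  have "filterlim (\<lambda>t. deriv (fin f) (?u t) * (y - x)) at_bot (at_right 0)"
    using f x y by (auto simp: legendre_def)
  moreover have "\<forall>\<^sub>F t in at_right 0. deriv (fin f) (?u t) * (y - x) = p (?u t) * (y - x)"
  proof -
    have uI: "?u t \<in> interior (edom f)" if "0 < t" "t < 1" for t
    proof -
      have "x - t *\<^sub>R (x - y) \<in> interior (edom f)"
        using x that by (intro mem_interior_closure_convex_shrink[OF cD y]) (auto simp: frontier_def)
      then show ?thesis
        by (simp add: algebra_simps)
    qed
    have "\<forall>\<^sub>F t in at_right 0. ?u t \<in> interior (edom f)"
      using uI by (auto simp: eventually_at_right_field intro!: exI[of _ 1])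
    moreover have "\<forall>\<^sub>F t in at_right 0. ?u t \<in> S"
      using topological_tendstoD[OF u S(1,2)] .
    ultimately show ?thesis
    proof eventually_elim
      case (elim t)
      have "(fin f has_real_derivative p (?u t)) (at (?u t))"
      proof (rule deriv_eq_on_open)
        show "(F has_real_derivative p (?u t)) (at (?u t))"
          using elim(2) by (rule S(3))
        show "fin f y = F y" if "y \<in> interior (edom f)" for y
          using F[of y] that interior_subset[of "edom f"] by (auto simp: fin_def)
      qed (use elim(1) in auto)
      then show ?case
        by (simp add: DERIV_imp_deriv)
    qed
  qed
  ultimately have "filterlim (\<lambda>t. p (?u t) * (y - x)) at_bot (at_right 0)"
    using filterlim_cong[OF refl refl] by fast
  from not_tendsto_and_filterlim_at_infinity[OF _ lim filterlim_at_bot_imp_at_infinity[OF this]]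
  show False
    by simp
qed

lemma legendre_contains_smooth_component:
  assumes f: "legendre f" and F: "\<And>x. x \<in> edom f \<Longrightarrow> f x = ereal (F x)"
    and S: "open S" "connected S" "\<And>u. u \<in> S \<Longrightarrow> (F has_real_derivative p u) (at u)"
      "continuous_on S p"
    and "S \<inter> edom f \<noteq> {}"
  shows "S \<subseteq> edom f"
  using connected_Int_frontier[OF S(2) \<open>S \<inter> edom f \<noteq> {}\<close>]
    legendre_not_frontier[OF f F S(1) _ S(3,4)] by blast

lemma legendre_contains_limit:
  assumes f: "legendre f" and F: "\<And>x. x \<in> edom f \<Longrightarrow> f x = ereal (F x)"
    and S: "S \<subseteq> edom f" "at x within S \<noteq> bot" "(F \<longlongrightarrow> l) (at x within S)"
  shows "x \<in> edom f"
proof (rule ccontr)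
  assume "x \<notin> edom f"
  then have "f x = \<infinity>"
    by (auto simp: edom_def)
  then have "ereal (l + 1) < f x"
    by simp
  also have "f x \<le> Liminf (at x) f"
    using f by (auto simp: legendre_def)
  finally have "\<forall>\<^sub>F u in at x. ereal (l + 1) < f u"
    by (simp add: less_LiminfD)
  then have "\<forall>\<^sub>F u in at x within S. ereal (l + 1) < f u"
    by (auto simp: eventually_at_filter elim: eventually_mono)
  moreover have "\<forall>\<^sub>F u in at x within S. u \<in> S"
    by (simp add: eventually_at_filter)
  moreover have "\<forall>\<^sub>F u in at x within S. F u < l + 1"
    using S(3) by (rule order_tendstoD) simp
  ultimately have "\<forall>\<^sub>F u in at x within S. False"
    by eventually_elim (use F S(1) in force)
  then show False
    using S(2) by simp
qed

section \<open>Absolute powers and their derivatives\<close>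

lemma tendsto_abs_powr_0: "0 < r \<Longrightarrow> ((\<lambda>x::real. \<bar>x\<bar> powr r) \<longlongrightarrow> 0) (at 0 within S)"
  by (rule tendsto_eq_intros tendsto_powr' refl | simp)+

lemma has_real_derivative_sgn_abs_powr:
  assumes "x \<noteq> 0 \<or> 1 < r"
  shows "((\<lambda>x. sgn x * \<bar>x\<bar> powr r) has_real_derivative r * \<bar>x\<bar> powr (r - 1)) (at x)"
proof -
  consider "0 < x" | "x < 0" | "x = 0" "1 < r"
    using assms by linarith
  then show ?thesis
  proof cases
    case 1
    then show ?thesis
      using deriv_eq_on_open[OF _ _ _ has_real_derivative_powr[OF 1],
          of "{0<..}" "\<lambda>x. sgn x * \<bar>x\<bar> powr r" r] by simp
  next
    case 2
    then have "((\<lambda>x. x powr r) has_real_derivative r * (- x) powr (r - 1)) (at (- x))"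
      by (simp add: has_real_derivative_powr)
    from DERIV_minus[OF DERIV_chain2[OF this DERIV_minus[OF DERIV_ident]]]
    have "((\<lambda>x. - ((- x) powr r)) has_real_derivative r * (- x) powr (r - 1)) (at x)"
      by simp
    from deriv_eq_on_open[OF _ _ _ this, of "{..<0}" "\<lambda>x. sgn x * \<bar>x\<bar> powr r"] show ?thesis
      using 2 by simp
  next
    case 3
    have "((\<lambda>h. sgn h * \<bar>h\<bar> powr r / h) \<longlongrightarrow> 0) (at 0)"
    proof (rule Lim_transform_eventually[OF tendsto_abs_powr_0[of "r - 1"]])
      have "\<bar>h\<bar> powr (r - 1) = sgn h * \<bar>h\<bar> powr r / h" if "h \<noteq> 0" for h
        using that by (cases "0 < h") (simp_all add: powr_diff)
      then show "\<forall>\<^sub>F h in at 0. \<bar>h\<bar> powr (r - 1) = sgn h * \<bar>h\<bar> powr r / h"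
        by (simp add: eventually_at_filter)
    qed (use 3 in simp)
    then show ?thesis
      using 3 by (simp add: DERIV_def)
  qed
qed

lemma has_real_derivative_abs_powr:
  assumes "x \<noteq> 0 \<or> 1 < r"
  shows "((\<lambda>x. \<bar>x\<bar> powr r) has_real_derivative r * (sgn x * \<bar>x\<bar> powr (r - 1))) (at x)"
proof -
  consider "0 < x" | "x < 0" | "x = 0" "1 < r"
    using assms by linarith
  then show ?thesis
  proof cases
    case 1
    then show ?thesis
      using deriv_eq_on_open[OF _ _ _ has_real_derivative_sgn_abs_powr[OF assms],
          of "{0<..}" "\<lambda>x. \<bar>x\<bar> powr r"] by simp
  next
    case 2
    then show ?thesis
      using deriv_eq_on_open[OF _ _ _ DERIV_minus[OF has_real_derivative_sgn_abs_powr[OF assms]],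
          of "{..<0}" "\<lambda>x. \<bar>x\<bar> powr r"] by simp
  next
    case 3
    have "((\<lambda>h. \<bar>h\<bar> powr r / h) \<longlongrightarrow> 0) (at 0)"
    proof (rule tendsto_norm_zero_cancel, rule Lim_transform_eventually[OF tendsto_abs_powr_0[of "r - 1"]])
      have "\<bar>h\<bar> powr (r - 1) = norm (\<bar>h\<bar> powr r / h)" if "h \<noteq> 0" for h
        using that by (simp add: powr_diff)
      then show "\<forall>\<^sub>F h in at 0. \<bar>h\<bar> powr (r - 1) = norm (\<bar>h\<bar> powr r / h)"
        by (simp add: eventually_at_filter)
    qed (use 3 in simp)
    then show ?thesis
      using 3 by (simp add: DERIV_def)
  qed
qed

section \<open>The gradients of the base functions\<close>

text \<open>
  The odd extension \<open>sgn x * \<bar>x\<bar> powr r\<close> is the real power with an exponent in \<open>R_odd\<close>, which is the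
  parity of \<open>\<beta> - 1\<close> and \<open>1 / (\<beta> - 1)\<close> when \<open>\<beta> \<in> R_even\<close>.  Hence one formula serves both half-lines
  and the whole line.  At \<open>\<beta> = 0\<close> the gradient becomes
  \<open>-1 / x\<close>, the derivative of \<open>- ln x\<close>.
\<close>

definition grad_Phi :: "real \<Rightarrow> real \<Rightarrow> real" where
  "grad_Phi \<beta> x = (if \<beta> = 1 then ln x else sgn x * \<bar>x\<bar> powr (\<beta> - 1) / (\<beta> - 1))"

definition grad_Psi :: "real \<Rightarrow> real \<Rightarrow> real" where
  "grad_Psi \<beta> y = (if \<beta> = 1 then exp y
     else sgn ((\<beta> - 1) * y) * \<bar>(\<beta> - 1) * y\<bar> powr (1 / (\<beta> - 1)))"

lemma grad_Phi_grad_Psi: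
  assumes "\<beta> \<noteq> 1"
  shows "grad_Phi \<beta> (grad_Psi \<beta> y) = y"
proof (cases "y = 0")
  case False
  define a where "a = (\<beta> - 1) * y"
  have a: "a \<noteq> 0"
    using False assms by (simp add: a_def)
  have q: "grad_Psi \<beta> y = sgn a * \<bar>a\<bar> powr (1 / (\<beta> - 1))"
    using assms by (simp add: grad_Psi_def a_def)
  have "sgn (grad_Psi \<beta> y) = sgn a" "\<bar>grad_Psi \<beta> y\<bar> = \<bar>a\<bar> powr (1 / (\<beta> - 1))"
    using a by (simp_all add: q sgn_mult abs_mult)
  then show ?thesis
    using assms a sgn_mult_abs[of a] by (simp add: grad_Phi_def powr_powr) (simp add: a_def)
qed (simp add: grad_Phi_def grad_Psi_def assms)

lemma has_real_derivative_power_Phi: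
  assumes "\<beta> \<noteq> 0" "\<beta> \<noteq> 1" "x \<noteq> 0 \<or> 1 < \<beta>"
  shows "((\<lambda>x. \<bar>x\<bar> powr \<beta> / (\<beta> * (\<beta> - 1))) has_real_derivative grad_Phi \<beta> x) (at x)"
  using DERIV_cdivide[OF has_real_derivative_abs_powr[OF assms(3)], of "\<beta> * (\<beta> - 1)"] assms(1,2)
  by (simp add: grad_Phi_def)

lemma has_real_derivative_power_Psi:
  assumes "\<beta> \<noteq> 0" "\<beta> \<noteq> 1" "y \<noteq> 0 \<or> 1 < \<beta>"
  shows "((\<lambda>y. \<bar>(\<beta> - 1) * y\<bar> powr (\<beta> / (\<beta> - 1)) / \<beta>) has_real_derivative grad_Psi \<beta> y) (at y)"
proof -
  have r: "\<beta> / (\<beta> - 1) - 1 = 1 / (\<beta> - 1)"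
    using assms(2) by (simp add: field_simps)
  have "(\<beta> - 1) * y \<noteq> 0 \<or> 1 < \<beta> / (\<beta> - 1)"
    using assms by auto
  from DERIV_cdivide[OF DERIV_chain2[OF has_real_derivative_abs_powr[OF this]
        DERIV_cmult[OF DERIV_ident]], of \<beta>]
  show ?thesis
    using assms(1,2) unfolding r by (simp add: grad_Psi_def)
qed

lemma abs_grad_Psi: "\<beta> \<noteq> 1 \<Longrightarrow> \<bar>grad_Psi \<beta> y\<bar> = \<bar>(\<beta> - 1) * y\<bar> powr (1 / (\<beta> - 1))"
  by (cases "y = 0") (simp_all add: grad_Psi_def abs_mult abs_sgn_eq)

lemma has_real_derivative_grad_Psi:
  assumes "\<beta> \<noteq> 1" "y \<noteq> 0 \<or> 1 < \<beta> \<and> \<beta> < 2"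
  shows "(grad_Psi \<beta> has_real_derivative \<bar>grad_Psi \<beta> y\<bar> powr (2 - \<beta>)) (at y)"
proof -
  have r: "1 / (\<beta> - 1) - 1 = (2 - \<beta>) / (\<beta> - 1)"
    using assms(1) by (simp add: field_simps)
  have "(\<beta> - 1) * y \<noteq> 0 \<or> 1 < 1 / (\<beta> - 1)"
    using assms by auto
  from DERIV_chain2[OF has_real_derivative_sgn_abs_powr[OF this] DERIV_cmult[OF DERIV_ident]]
  show ?thesis
    using assms(1) unfolding abs_grad_Psi[OF assms(1)] r
    by (simp add: grad_Psi_def[abs_def] powr_powr)
qed

lemma grad_Psi_2 [simp]: "grad_Psi 2 y = y"
  by (simp add: grad_Psi_def sgn_mult_abs)

text \<open>
  For \<open>\<beta> < 1\<close> the gradient of \<open>\<Phi>\<close> exchanges the half-lines on the two sides of \<open>0\<close>; the sign \<open>s\<close>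
  treats the two branches at once.
\<close>

lemma gradients_halfline:
  assumes "\<beta> < 1" "\<bar>s\<bar> = 1"
  shows "strict_mono_on {x. 0 < s * x} (grad_Phi \<beta>)"
    and "0 < s * x \<Longrightarrow> s * grad_Phi \<beta> x < 0"
    and "s * y < 0 \<Longrightarrow> 0 < s * grad_Psi \<beta> y"
proof -
  have s: "s = 1 \<or> s = -1"
    using assms(2) by linarith
  show "strict_mono_on {x. 0 < s * x} (grad_Phi \<beta>)"
  proof (rule strict_mono_onI)
    fix x y assume xy: "x \<in> {x. 0 < s * x}" "y \<in> {x. 0 < s * x}" "x < y"
    show "grad_Phi \<beta> x < grad_Phi \<beta> y"
    proof (cases "s = 1")
      case True
      then have "y powr (\<beta> - 1) < x powr (\<beta> - 1)"
        using xy assms(1) by (intro powr_less_mono2_neg) auto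
      then show ?thesis
        using True xy assms(1) by (auto simp: grad_Phi_def divide_strict_right_mono_neg)
    next
      case False
      then have "(- x) powr (\<beta> - 1) < (- y) powr (\<beta> - 1)"
        using xy s assms(1) by (intro powr_less_mono2_neg) auto
      then show ?thesis
        using False s xy assms(1) by (auto simp: grad_Phi_def divide_strict_right_mono_neg)
    qed
  qed
  show "0 < s * x \<Longrightarrow> s * grad_Phi \<beta> x < 0"
    using s assms(1) by (auto simp: grad_Phi_def divide_pos_neg divide_neg_neg)
  show "s * y < 0 \<Longrightarrow> 0 < s * grad_Psi \<beta> y"
    using s assms(1) by (auto simp: grad_Psi_def sgn_mult zero_less_mult_iff mult_less_0_iff)
qed

lemma strict_mono_grad_Phi:
  assumes "1 < \<beta>"
  shows "strict_mono (grad_Phi \<beta>)"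
proof (rule strict_monoI)
  fix x y :: real assume "x < y"
  have "sgn x * \<bar>x\<bar> powr (\<beta> - 1) < sgn y * \<bar>y\<bar> powr (\<beta> - 1)"
  proof -
    consider "0 \<le> x" | "x < 0" "0 \<le> y" | "y < 0"
      by linarith
    then show ?thesis
    proof cases
      case 1
      then show ?thesis
        using \<open>x < y\<close> assms powr_less_mono2[of "\<beta> - 1" x y] by (cases "x = 0") auto
    next
      case 2
      then have "sgn x * \<bar>x\<bar> powr (\<beta> - 1) < 0"
        by simp
      also have "0 \<le> sgn y * \<bar>y\<bar> powr (\<beta> - 1)"
        using 2 by simp
      finally show ?thesis .
    next
      case 3
      then show ?thesis
        using \<open>x < y\<close> assms powr_less_mono2[of "\<beta> - 1" "- y" "- x"] by auto
    qed
  qed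
  then show "grad_Phi \<beta> x < grad_Phi \<beta> y"
    using assms by (simp add: grad_Phi_def divide_strict_right_mono)
qed

section \<open>Smoothness and convexity of the base functions\<close>

lemma interior_halfline:
  assumes "\<bar>s\<bar> = (1::real)"
  shows "interior {x. 0 \<le> s * x} = {x. 0 < s * x}" "interior {x. 0 < s * x} = {x. 0 < s * x}"
    "interior {x. s * x < 0} = {x. s * x < 0}"
    "convex {x. 0 \<le> s * x}" "convex {x. 0 < s * x}" "convex {x. s * x < 0}"
    "{x. 0 < s * x} \<noteq> {}" "open {x. s * x < 0}"
proof -
  have "s = 1 \<or> s = -1"
    using assms by linarith
  moreover have "{x. 0 \<le> x} = {0::real..}" "{x. x \<le> 0} = {..0::real}" "{x. 0 < x} = {0::real<..}"
    "{x. x < 0} = {..<0::real}" "(1::real) \<in> {0<..}" "(-1::real) \<in> {..<0}"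
    by auto
  ultimately show "interior {x. 0 \<le> s * x} = {x. 0 < s * x}"
    "interior {x. 0 < s * x} = {x. 0 < s * x}"
    "interior {x. s * x < 0} = {x. s * x < 0}"
    "convex {x. 0 \<le> s * x}" "convex {x. 0 < s * x}" "convex {x. s * x < 0}"
    "{x. 0 < s * x} \<noteq> {}" "open {x. s * x < 0}"
    by (auto simp: interior_open gt_ex lt_ex)
qed

lemma power_pair_halfline:
  assumes \<beta>: "0 < \<beta>" "\<beta> < 1" and s: "\<bar>s\<bar> = 1"
  defines "D \<equiv> {x. 0 \<le> s * x}" and "E \<equiv> {y. s * y < 0}"
  shows "smooth_convex D (\<lambda>x. \<bar>x\<bar> powr \<beta> / (\<beta> * (\<beta> - 1))) (grad_Phi \<beta>)"
    "smooth_convex E (\<lambda>y. \<bar>(\<beta> - 1) * y\<bar> powr (\<beta> / (\<beta> - 1)) / \<beta>) (grad_Psi \<beta>)"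
    "grad_Phi \<beta> ` interior D = E" "grad_Psi \<beta> ` E = interior D"
proof -
  note g = gradients_halfline[OF \<beta>(2) s] and ih = interior_halfline[OF s]
  have c: "continuous_on D (\<lambda>x. \<bar>x\<bar> powr \<beta> / (\<beta> * (\<beta> - 1)))"
    using \<beta> by (intro continuous_intros continuous_on_powr') auto
  note * = inverse_gradients_smooth_convex[of D E "grad_Phi \<beta>" "grad_Psi \<beta>"
      "\<lambda>x. \<bar>x\<bar> powr \<beta> / (\<beta> * (\<beta> - 1))" "\<lambda>y. \<bar>(\<beta> - 1) * y\<bar> powr (\<beta> / (\<beta> - 1)) / \<beta>"]
  show "smooth_convex D (\<lambda>x. \<bar>x\<bar> powr \<beta> / (\<beta> * (\<beta> - 1))) (grad_Phi \<beta>)"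
    "smooth_convex E (\<lambda>y. \<bar>(\<beta> - 1) * y\<bar> powr (\<beta> / (\<beta> - 1)) / \<beta>) (grad_Psi \<beta>)"
    "grad_Phi \<beta> ` interior D = E" "grad_Psi \<beta> ` E = interior D"
    by (rule *; (rule c)?; use \<beta> g ih in \<open>auto simp: D_def E_def grad_Phi_grad_Psi
        intro!: has_real_derivative_power_Phi has_real_derivative_power_Psi\<close>)+
qed

lemma power_pair_line:
  assumes \<beta>: "1 < \<beta>"
  shows "smooth_convex UNIV (\<lambda>x. \<bar>x\<bar> powr \<beta> / (\<beta> * (\<beta> - 1))) (grad_Phi \<beta>)"
    "smooth_convex UNIV (\<lambda>y. \<bar>(\<beta> - 1) * y\<bar> powr (\<beta> / (\<beta> - 1)) / \<beta>) (grad_Psi \<beta>)"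
    "range (grad_Phi \<beta>) = UNIV" "range (grad_Psi \<beta>) = UNIV"
proof -
  have c: "continuous_on UNIV (\<lambda>x. \<bar>x\<bar> powr \<beta> / (\<beta> * (\<beta> - 1)))"
    using \<beta> by (intro continuous_intros continuous_on_powr') auto
  note * = inverse_gradients_smooth_convex[of UNIV UNIV "grad_Phi \<beta>" "grad_Psi \<beta>"
      "\<lambda>x. \<bar>x\<bar> powr \<beta> / (\<beta> * (\<beta> - 1))" "\<lambda>y. \<bar>(\<beta> - 1) * y\<bar> powr (\<beta> / (\<beta> - 1)) / \<beta>",
      unfolded interior_UNIV]
  show "smooth_convex UNIV (\<lambda>x. \<bar>x\<bar> powr \<beta> / (\<beta> * (\<beta> - 1))) (grad_Phi \<beta>)"
    "smooth_convex UNIV (\<lambda>y. \<bar>(\<beta> - 1) * y\<bar> powr (\<beta> / (\<beta> - 1)) / \<beta>) (grad_Psi \<beta>)"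
    "range (grad_Phi \<beta>) = UNIV" "range (grad_Psi \<beta>) = UNIV"
    by (rule *; (rule c)?; use \<beta> strict_mono_grad_Phi[OF \<beta>] in \<open>auto simp: grad_Phi_grad_Psi
        intro!: has_real_derivative_power_Phi has_real_derivative_power_Psi\<close>)+
qed

lemma log_pair:
  shows "smooth_convex {0<..} (Phi_val 0) (grad_Phi 0)"
    "smooth_convex {..<0} (Psi_val 0) (grad_Psi 0)"
    "grad_Phi 0 ` {0<..} = {..<0}" "grad_Psi 0 ` {..<0} = {0<..}"
proof -
  have g: "strict_mono_on {0<..} (grad_Phi 0)" "\<And>x. 0 < x \<Longrightarrow> grad_Phi 0 x < 0"
    "\<And>y. y < 0 \<Longrightarrow> 0 < grad_Psi 0 y"
    using gradients_halfline[of 0 1] by (auto simp: greaterThan_def)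
  have d: "(Phi_val 0 has_real_derivative grad_Phi 0 x) (at x)" if "0 < x" for x
    using that by (auto simp: Phi_val_def[abs_def] grad_Phi_def powr_minus_divide
        intro!: derivative_eq_intros)
  have d': "(Psi_val 0 has_real_derivative grad_Psi 0 y) (at y)" if "y < 0" for y
    using that by (auto simp: Psi_val_def[abs_def] grad_Psi_def powr_minus_divide
        intro!: derivative_eq_intros)
  have c: "continuous_on {0<..} (Phi_val 0)"
    by (auto simp: Phi_val_def[abs_def] intro!: continuous_intros)
  note * = inverse_gradients_smooth_convex[of "{0<..}" "{..<0}" "grad_Phi 0" "grad_Psi 0"
      "Phi_val 0" "Psi_val 0", unfolded interior_open[OF open_greaterThan]]
  show "smooth_convex {0<..} (Phi_val 0) (grad_Phi 0)"
    "smooth_convex {..<0} (Psi_val 0) (grad_Psi 0)"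
    "grad_Phi 0 ` {0<..} = {..<0}" "grad_Psi 0 ` {..<0} = {0<..}"
    by (rule *; (rule c)?; use g d d' in \<open>auto simp: grad_Phi_grad_Psi\<close>)+
qed

lemma entropy_pair:
  shows "smooth_convex {0..} (Phi_val 1) (grad_Phi 1)"
    "smooth_convex UNIV (Psi_val 1) (grad_Psi 1)"
    "grad_Phi 1 ` {0<..} = UNIV" "grad_Psi 1 ` UNIV = {0<..}"
proof -
  have d: "(Phi_val 1 has_real_derivative grad_Phi 1 x) (at x)" if "0 < x" for x
    using that by (auto simp: Phi_val_def[abs_def] grad_Phi_def intro!: derivative_eq_intros)
  have d': "(Psi_val 1 has_real_derivative grad_Psi 1 y) (at y)" for y
    by (auto simp: Psi_val_def[abs_def] grad_Psi_def intro!: derivative_eq_intros)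
  have lim: "((\<lambda>x::real. x * ln x - x) \<longlongrightarrow> 0) (at_right 0)"
    by real_asymp
  have c: "continuous_on {0..} (Phi_val 1)"
    unfolding continuous_on_def
  proof
    fix x :: real assume "x \<in> {0..}"
    then consider "x = 0" | "0 < x"
      by force
    then show "(Phi_val 1 \<longlongrightarrow> Phi_val 1 x) (at x within {0..})"
    proof cases
      case 1
      have "at (0::real) within {0..} = at_right 0"
        by (intro at_within_nhd[of 0 UNIV]) auto
      then show ?thesis
        using 1 lim by (simp add: Phi_val_def[abs_def])
    next
      case 2
      then show ?thesis
        using DERIV_isCont[OF d[OF 2]] continuous_at_imp_continuous_at_within
        by (auto simp: continuous_within)
    qed
  qed
  note * = inverse_gradients_smooth_convex[of "{0..}" UNIV "grad_Phi 1" "grad_Psi 1"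
      "Phi_val 1" "Psi_val 1", unfolded interior_real_atLeast]
  show "smooth_convex {0..} (Phi_val 1) (grad_Phi 1)"
    "smooth_convex UNIV (Psi_val 1) (grad_Psi 1)"
    "grad_Phi 1 ` {0<..} = UNIV" "grad_Psi 1 ` UNIV = {0<..}"
    by (rule *; (rule c)?; use d d' in \<open>auto simp: grad_Phi_def grad_Psi_def intro!: strict_mono_onI\<close>)+
qed

section \<open>The base functions on their domains\<close>

lemma smooth_convex_cong:
  assumes "smooth_convex D F p" "\<And>x. x \<in> D \<Longrightarrow> F x = G x"
  shows "smooth_convex D G p"
proof -
  interpret smooth_convex D F p by fact
  have "(G has_real_derivative p x) (at x)" if "x \<in> interior D" for x
    using interior_subset[of D] assms(2)
    by (intro deriv_eq_on_open[OF _ that _ deriv[OF that]]) auto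
  moreover have "continuous_on D G"
    using cont assms(2) by (simp cong: continuous_on_cong)
  ultimately show ?thesis
    using convex interior_nonempty strict_mono cont_deriv by unfold_locales auto
qed

lemma Phi_val_power:
  assumes "\<beta> \<noteq> 0" "\<beta> \<noteq> 1" "0 \<le> x \<or> \<beta> \<in> R_even"
  shows "Phi_val \<beta> x = \<bar>x\<bar> powr \<beta> / (\<beta> * (\<beta> - 1))"
  using assms by (simp add: Phi_val_def rpow_eq_abs_powr)

lemma Psi_val_power:
  assumes "\<beta> \<noteq> 0" "\<beta> \<noteq> 1" "0 \<le> (\<beta> - 1) * y \<or> \<beta> \<in> R_even"
  shows "Psi_val \<beta> y = \<bar>(\<beta> - 1) * y\<bar> powr (\<beta> / (\<beta> - 1)) / \<beta>"
  using assms by (auto simp: Psi_val_def rpow_eq_abs_powr R_even_conjugate_exponent)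

lemma base_domains_cases:
  assumes "(D, E) \<in> base_domains \<beta>"
  obtains (line) "1 < \<beta>" "\<beta> \<le> 2" "\<beta> \<in> R_even" "D = UNIV" "E = UNIV"
    | (entropy) "\<beta> = 1" "D = {0..}" "E = UNIV"
    | (power) s where "0 < \<beta>" "\<beta> < 1" "\<bar>s\<bar> = 1" "s = 1 \<or> \<beta> \<in> R_even"
        "D = {x. 0 \<le> s * x}" "E = {y. s * y < 0}"
    | (log) "\<beta> = 0" "D = {0<..}" "E = {..<0}"
proof -
  have "{0..} = {x::real. 0 \<le> 1 * x}" "{..<0} = {y::real. 1 * y < 0}"
    "{..0} = {x::real. 0 \<le> -1 * x}" "{0<..} = {y::real. -1 * y < 0}"
    by auto
  then show ?thesis
    using assms that power[of 1] power[of "-1"] unfolding base_domains_def by auto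
qed

lemma
  assumes "(D, E) \<in> base_domains \<beta>"
  shows smooth_convex_Phi: "smooth_convex D (Phi_val \<beta>) (grad_Phi \<beta>)"
    and smooth_convex_Psi: "smooth_convex E (Psi_val \<beta>) (grad_Psi \<beta>)"
    and grad_Phi_image: "grad_Phi \<beta> ` interior D = E"
    and grad_Psi_image: "grad_Psi \<beta> ` E = interior D"
    and open_Psi_domain: "open E"
proof -
  from assms
  have "smooth_convex D (Phi_val \<beta>) (grad_Phi \<beta>) \<and> smooth_convex E (Psi_val \<beta>) (grad_Psi \<beta>) \<and>
    grad_Phi \<beta> ` interior D = E \<and> grad_Psi \<beta> ` E = interior D \<and> open E"
  proof (cases rule: base_domains_cases)
    case line
    then show ?thesis
      using power_pair_line[of \<beta>]
      by (auto intro: smooth_convex_cong simp: Phi_val_power Psi_val_power)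
  next
    case entropy
    then show ?thesis
      using entropy_pair by auto
  next
    case (power s)
    have "s = 1 \<or> s = -1"
      using power by linarith
    then have "0 \<le> x \<or> \<beta> \<in> R_even" if "x \<in> D" for x
      using that power by auto
    moreover have "0 \<le> (\<beta> - 1) * y \<or> \<beta> \<in> R_even" if "y \<in> E" for y
      using that power by (auto simp: zero_le_mult_iff)
    ultimately show ?thesis
      using power_pair_halfline[of \<beta> s] power interior_halfline[of s]
      by (auto intro!: smooth_convex_cong[OF power_pair_halfline(1)]
          smooth_convex_cong[OF power_pair_halfline(2)] simp: Phi_val_power Psi_val_power)
  next
    case log
    then show ?thesis
      using log_pair by (auto simp: interior_open)
  qed
  then show "smooth_convex D (Phi_val \<beta>) (grad_Phi \<beta>)" "smooth_convex E (Psi_val \<beta>) (grad_Psi \<beta>)"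
    "grad_Phi \<beta> ` interior D = E" "grad_Psi \<beta> ` E = interior D" "open E"
    by blast+
qed

lemma Phi_defined_base:
  assumes "(D, E) \<in> base_domains \<beta>" "x \<in> D"
  shows "Phi_defined \<beta> x"
  using assms(1)
proof (cases rule: base_domains_cases)
  case (power s)
  have "s = 1 \<or> s = -1"
    using power by linarith
  then show ?thesis
    using power assms(2) by (auto simp: Phi_defined_def rpow_defined_def)
qed (use assms(2) in \<open>auto simp: Phi_defined_def rpow_defined_def\<close>)

lemma Psi_defined_base:
  assumes "(D, E) \<in> base_domains \<beta>" "y \<in> E"
  shows "Psi_defined \<beta> y"
  using assms(1)
proof (cases rule: base_domains_cases)
  case (power s)
  have "s = 1 \<or> s = -1"
    using power by linarith
  then show ?thesis
    using power assms(2) R_even_conjugate_exponent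
    by (auto simp: Psi_defined_def rpow_defined_def zero_less_mult_iff mult_less_0_iff)
qed (use assms(2) R_even_conjugate_exponent in
    \<open>auto simp: Psi_defined_def rpow_defined_def not_less intro: divide_nonneg_pos\<close>)

lemma has_real_derivative_grad_Psi_base:
  assumes "(D, E) \<in> base_domains \<beta>" "y \<in> E"
  shows "(grad_Psi \<beta> has_real_derivative rpow (grad_Psi \<beta> y) (2 - \<beta>)) (at y)"
    and "rpow_defined (grad_Psi \<beta> y) (2 - \<beta>)"
    and "0 \<le> rpow (grad_Psi \<beta> y) (2 - \<beta>)"
proof -
  have "grad_Psi \<beta> y \<in> interior D"
    using grad_Psi_image[OF assms(1)] assms(2) by auto
  then have q: "grad_Psi \<beta> y \<in> D"
    using interior_subset by auto
  have e: "\<beta> \<le> 2" "0 \<le> grad_Psi \<beta> y \<or> 2 - \<beta> \<in> R_even"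
    using assms(1)
    by (cases rule: base_domains_cases; use q R_even_two_minus[of \<beta>] in auto)+
  show "rpow_defined (grad_Psi \<beta> y) (2 - \<beta>)"
    using e by (auto simp: rpow_defined_def)
  show "0 \<le> rpow (grad_Psi \<beta> y) (2 - \<beta>)"
    using e by (auto simp: rpow_def)
  show "(grad_Psi \<beta> has_real_derivative rpow (grad_Psi \<beta> y) (2 - \<beta>)) (at y)"
  proof -
    consider "\<beta> = 2" | "\<beta> = 1" | "\<beta> \<noteq> 1" "\<beta> < 2"
      using e(1) by linarith
    then show ?thesis
    proof cases
      case 1
      moreover have "grad_Psi 2 = (\<lambda>y. y)"
        by (simp add: fun_eq_iff)
      ultimately show ?thesis
        by (simp add: rpow_def)
    next
      case 2
      then show ?thesis
        by (auto simp: grad_Psi_def[abs_def] rpow_def intro!: derivative_eq_intros)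
    next
      case 3
      have "y \<noteq> 0 \<or> 1 < \<beta> \<and> \<beta> < 2"
        using assms(1) by (cases rule: base_domains_cases) (use assms(2) 3 in auto)
      then show ?thesis
        using has_real_derivative_grad_Psi[of \<beta> y] 3 e(2) by (simp add: rpow_eq_abs_powr)
    qed
  qed
qed

lemma continuous_on_variance_function:
  assumes "(D, E) \<in> base_domains \<beta>"
  shows "continuous_on E (\<lambda>y. rpow (grad_Psi \<beta> y) (2 - \<beta>))"
proof -
  interpret smooth_convex E "Psi_val \<beta>" "grad_Psi \<beta>"
    using smooth_convex_Psi[OF assms] .
  have c: "continuous_on E (grad_Psi \<beta>)"
    using cont_deriv open_Psi_domain[OF assms] by (simp add: interior_open)
  have "grad_Psi \<beta> y \<in> D" if "y \<in> E" for y
    using grad_Psi_image[OF assms] that interior_subset by blast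
  then have e: "\<beta> \<le> 2 \<and> (\<forall>y\<in>E. 0 \<le> grad_Psi \<beta> y \<or> 2 - \<beta> \<in> R_even)"
    by - (use assms in \<open>cases rule: base_domains_cases\<close>; use R_even_two_minus[of \<beta>] in force)
  show ?thesis
  proof (cases "\<beta> = 2")
    case False
    have "continuous_on E (\<lambda>y. \<bar>grad_Psi \<beta> y\<bar> powr (2 - \<beta>))"
      using c False e by (intro continuous_on_powr' continuous_intros) auto
    moreover have "rpow (grad_Psi \<beta> y) (2 - \<beta>) = \<bar>grad_Psi \<beta> y\<bar> powr (2 - \<beta>)" if "y \<in> E" for y
      using False e that by (intro rpow_eq_abs_powr) auto
    ultimately show ?thesis
      by (simp cong: continuous_on_cong)
  qed (simp add: rpow_def)
qed

lemma legendre_Phi_base: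
  assumes "(D, E) \<in> base_domains \<beta>"
  shows "legendre (extend D (Phi_val \<beta>))"
proof -
  interpret smooth_convex D "Phi_val \<beta>" "grad_Phi \<beta>"
    using smooth_convex_Phi[OF assms] .
  note im = grad_Phi_image[OF assms]
  from assms show ?thesis
  proof (cases rule: base_domains_cases)
    case line
    then show ?thesis
      by (intro legendre_extend_UNIV)
  next
    case entropy
    show ?thesis
    proof (rule legendre_extend_halfline[of 1])
      fix K :: real
      have "K - 1 \<in> grad_Phi \<beta> ` interior D"
        using im entropy by auto
      then show "\<exists>x. 0 < 1 * x \<and> 1 * grad_Phi \<beta> x < K"
        using entropy by auto
    qed (use entropy in auto)
  next
    case (power s)
    have s: "s * s = 1"
      using power(3) by (metis abs_mult_self_eq mult_1)
    note ih = interior_halfline[OF power(3)]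
    show ?thesis
    proof (rule legendre_extend_halfline[OF power(3)])
      fix K :: real
      have *: "s * (s * u) = u" for u
        using s by (simp add: mult.assoc[symmetric])
      have "s * (- \<bar>K\<bar> - 1) \<in> grad_Phi \<beta> ` interior D"
        using im power by (simp add: *)
      then obtain x where "x \<in> interior D" "grad_Phi \<beta> x = s * (- \<bar>K\<bar> - 1)"
        by auto
      then show "\<exists>x. 0 < s * x \<and> s * grad_Phi \<beta> x < K"
        using power ih by (intro exI[of _ x]) (simp add: *)
    qed (use power ih in auto)
  next
    case log
    show ?thesis
    proof (rule legendre_extend_halfline[of 1])
      fix K :: real
      have "- \<bar>K\<bar> - 1 \<in> grad_Phi \<beta> ` interior D"
        using im log by auto
      then show "\<exists>x. 0 < 1 * x \<and> 1 * grad_Phi \<beta> x < K"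
        using log by (auto simp: interior_open)
    next
      have "filterlim (\<lambda>x::real. - ln x) at_top (at_right 0)"
        by real_asymp
      then show "filterlim (Phi_val \<beta>) at_top (at 0 within D)"
        using log by (simp add: Phi_val_def[abs_def])
    qed (use log in \<open>auto simp: interior_open\<close>)
  qed
qed

lemma power_Psi_at_top:
  fixes \<beta> :: real
  assumes "0 < \<beta>" "\<beta> < 1" "0 \<notin> S"
  shows "filterlim (\<lambda>y. \<bar>(\<beta> - 1) * y\<bar> powr (\<beta> / (\<beta> - 1)) / \<beta>) at_top (at 0 within S)"
proof -
  define r where "r = \<beta> / (1 - \<beta>)"
  have r: "0 < r" "\<beta> / (\<beta> - 1) = - r"
    using assms minus_divide_right[of \<beta> "1 - \<beta>"] by (auto simp: r_def)
  have "((\<lambda>y. \<bar>(\<beta> - 1) * y\<bar> powr r * \<beta>) \<longlongrightarrow> 0) (at 0 within S)"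
    using r(1) by (auto intro!: tendsto_eq_intros tendsto_powr')
  then have "filterlim (\<lambda>y. inverse (\<bar>(\<beta> - 1) * y\<bar> powr r * \<beta>)) at_top (at 0 within S)"
    using assms by (intro filterlim_inverse_at_top) (auto simp: eventually_at_filter)
  then show ?thesis
    unfolding r(2) by (simp add: powr_minus divide_inverse)
qed

lemma legendre_Psi_base:
  assumes "(D, E) \<in> base_domains \<beta>"
  shows "legendre (extend E (Psi_val \<beta>))"
proof -
  interpret smooth_convex E "Psi_val \<beta>" "grad_Psi \<beta>"
    using smooth_convex_Psi[OF assms] .
  note im = grad_Psi_image[OF assms]
  from assms show ?thesis
  proof (cases rule: base_domains_cases)
    case (power s)
    have s: "s * s = 1"
      using power(3) by (metis abs_mult_self_eq mult_1)
    have *: "s * (s * u) = u" for u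
      using s by (simp add: mult.assoc[symmetric])
    note ih = interior_halfline[OF power(3)]
    show ?thesis
    proof (rule legendre_extend_halfline[of "- s"])
      fix K :: real
      have "s * (\<bar>K\<bar> + 1) \<in> grad_Psi \<beta> ` E"
        using im power ih by (simp add: *)
      then obtain y where "y \<in> E" "grad_Psi \<beta> y = s * (\<bar>K\<bar> + 1)"
        by auto
      then show "\<exists>y. 0 < - s * y \<and> - s * grad_Psi \<beta> y < K"
        using power by (intro exI[of _ y]) (simp add: *)
    next
      have "s = 1 \<or> s = -1"
        using power by linarith
      then have "0 \<le> (\<beta> - 1) * y \<or> \<beta> \<in> R_even" if "y \<in> E" for y
        using that power by (auto simp: zero_le_mult_iff)
      then have "\<forall>\<^sub>F y in at 0 within E.
          \<bar>(\<beta> - 1) * y\<bar> powr (\<beta> / (\<beta> - 1)) / \<beta> = Psi_val \<beta> y"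
        using power by (auto simp: eventually_at_filter Psi_val_power)
      from filterlim_cong[OF refl refl this] show "filterlim (Psi_val \<beta>) at_top (at 0 within E)"
        using power_Psi_at_top[of \<beta> E] power by simp
    qed (use power ih in auto)
  next
    case log
    show ?thesis
    proof (rule legendre_extend_halfline[of "-1"])
      fix K :: real
      have "\<bar>K\<bar> + 1 \<in> grad_Psi \<beta> ` E"
        using im log by (auto simp: interior_open)
      then obtain y where "y \<in> E" "grad_Psi \<beta> y = \<bar>K\<bar> + 1"
        by auto
      then show "\<exists>x. 0 < -1 * x \<and> -1 * grad_Psi \<beta> x < K"
        using log by (intro exI[of _ y]) auto
    next
      have "filterlim (\<lambda>x::real. - ln (- x)) at_top (at_left 0)"
        by real_asymp
      then show "filterlim (Psi_val \<beta>) at_top (at 0 within E)"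
        using log by (simp add: Psi_val_def[abs_def])
    qed (use log in \<open>auto simp: interior_open\<close>)
  qed (use legendre_extend_UNIV in auto)
qed

lemma grad_Psi_conjugate_value:
  assumes "\<beta> \<noteq> 0" "\<beta> \<noteq> 1"
  shows "grad_Psi \<beta> y * y - \<bar>grad_Psi \<beta> y\<bar> powr \<beta> / (\<beta> * (\<beta> - 1))
    = \<bar>(\<beta> - 1) * y\<bar> powr (\<beta> / (\<beta> - 1)) / \<beta>"
proof -
  define a where "a = (\<beta> - 1) * y"
  define W where "W = \<bar>a\<bar> powr (\<beta> / (\<beta> - 1))"
  have e: "1 + 1 / (\<beta> - 1) = \<beta> / (\<beta> - 1)"
    using assms(2) by (simp add: field_simps)
  have "grad_Psi \<beta> y * a = \<bar>a\<bar> * \<bar>a\<bar> powr (1 / (\<beta> - 1))"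
    using assms(2) by (simp add: grad_Psi_def a_def[symmetric] abs_sgn)
  also have "\<dots> = W"
    using powr_mult_base[of "\<bar>a\<bar>" "1 / (\<beta> - 1)"] unfolding e W_def by simp
  finally have "grad_Psi \<beta> y * y = W / (\<beta> - 1)"
    using assms(2) by (simp add: a_def field_simps)
  moreover have "\<bar>grad_Psi \<beta> y\<bar> powr \<beta> = W"
    using assms(2) by (simp add: abs_grad_Psi powr_powr a_def W_def)
  ultimately show ?thesis
    using assms unfolding W_def[symmetric] a_def[symmetric] by (simp add: field_simps)
qed

text \<open>
  For \<open>y \<in> E\<close> the supremum is attained at \<open>x = grad_Psi \<beta> y\<close>, where, for
  \<open>\<beta> \<notin> {0, 1}\<close>, both \<open>x * y\<close> and \<open>\<Phi> x\<close> are multiples of the same power of \<open>\<bar>y\<bar>\<close>.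
  For \<open>y \<notin> E\<close> the product \<open>x * y\<close> is nonnegative for \<open>x \<in> D\<close>, while \<open>- \<Phi> x\<close> is unbounded.
\<close>

lemma conjugate_Phi_base:
  assumes DE: "(D, E) \<in> base_domains \<beta>"
  shows "conjugate (extend D (Phi_val \<beta>)) y
    = extend E (Psi_val \<beta>) y + ereal (if \<beta> = 0 then -1 else 0)"
proof (cases "y \<in> E")
  case True
  interpret smooth_convex D "Phi_val \<beta>" "grad_Phi \<beta>"
    using smooth_convex_Phi[OF DE] .
  let ?x = "grad_Psi \<beta> y"
  have x: "?x \<in> interior D"
    using grad_Psi_image[OF DE] True by auto
  then have xD: "?x \<in> D"
    using interior_subset by auto
  have "grad_Phi \<beta> ?x = y"
    by (cases "\<beta> = 1") (simp add: grad_Phi_def grad_Psi_def, simp add: grad_Phi_grad_Psi)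
  then have "conjugate (extend D (Phi_val \<beta>)) y = ereal (?x * y - Phi_val \<beta> ?x)"
    using conjugate_extend[OF x] by simp
  also have "?x * y - Phi_val \<beta> ?x = Psi_val \<beta> y + (if \<beta> = 0 then -1 else 0)"
    using DE
  proof (cases rule: base_domains_cases)
    case line
    then show ?thesis
      using grad_Psi_conjugate_value[of \<beta> y] by (simp add: Phi_val_power Psi_val_power)
  next
    case (power s)
    have "s = 1 \<or> s = -1"
      using power by linarith
    then have "0 \<le> ?x \<or> \<beta> \<in> R_even" "0 \<le> (\<beta> - 1) * y \<or> \<beta> \<in> R_even"
      using True xD power by (auto simp: zero_le_mult_iff)
    then show ?thesis
      using grad_Psi_conjugate_value[of \<beta> y] power by (simp add: Phi_val_power Psi_val_power)
  next
    case log
    then show ?thesis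
      using True ln_inverse[of "- y"]
      by (simp add: Phi_val_def Psi_val_def grad_Psi_def powr_minus)
  qed (simp add: Phi_val_def Psi_val_def grad_Psi_def algebra_simps)
  finally show ?thesis
    using True by (simp add: extend_def[of E])
next
  case False
  have "conjugate (extend D (Phi_val \<beta>)) y = \<infinity>"
    using DE
  proof (cases rule: base_domains_cases)
    case (power s)
    have s: "s = 1 \<or> s = -1"
      using power by linarith
    show ?thesis
    proof (rule conjugate_extend_infinite)
      have "filterlim (\<lambda>t::real. t powr \<beta> / (\<beta> * (1 - \<beta>))) at_top at_top"
        using power by real_asymp
      then show "filterlim (\<lambda>t. s * t * y - Phi_val \<beta> (s * t)) at_top at_top"
      proof (rule filterlim_at_top_mono)
        have "t powr \<beta> / (\<beta> * (1 - \<beta>)) \<le> s * t * y - Phi_val \<beta> (s * t)" if "0 < t" for t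
        proof -
          have "Phi_val \<beta> (s * t) = - (t powr \<beta> / (\<beta> * (1 - \<beta>)))"
            using power that s
            by (subst Phi_val_power) (auto simp: field_simps)
          moreover have "0 \<le> s * t * y"
            using False power that s by (auto simp: not_less mult_nonneg_nonpos)
          ultimately show ?thesis
            by simp
        qed
        then show "\<forall>\<^sub>F t in at_top. t powr \<beta> / (\<beta> * (1 - \<beta>)) \<le> s * t * y - Phi_val \<beta> (s * t)"
          using eventually_gt_at_top[of 0] by (rule eventually_mono[rotated])
      qed
      show "\<forall>\<^sub>F t in at_top. s * t \<in> D"
        using eventually_ge_at_top[of 0] by eventually_elim (use power s in auto)
    qed simp
  next
    case log
    show ?thesis
    proof (rule conjugate_extend_infinite)
      have "filterlim (\<lambda>t::real. ln t) at_top at_top"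
        by real_asymp
      then show "filterlim (\<lambda>t. t * y - Phi_val \<beta> t) at_top at_top"
      proof (rule filterlim_at_top_mono)
        show "\<forall>\<^sub>F t in at_top. ln t \<le> t * y - Phi_val \<beta> t"
          using eventually_ge_at_top[of 0]
          by eventually_elim (use log False in \<open>auto simp: Phi_val_def\<close>)
      qed
      show "\<forall>\<^sub>F t in at_top. t \<in> D"
        using log eventually_gt_at_top[of 0] by simp
    qed simp
  qed (use False in auto)
  then show ?thesis
    using False by (simp add: extend_def)
qed

text \<open>
  Here \<open>x\<close> runs to infinity inside \<open>E\<close> in the direction in which \<open>x * y \<ge> 0\<close>.  There \<open>\<Psi>\<close> stays bounded
  for \<open>\<beta> > 0\<close>, while \<open>x * y\<close> grows linearly; for \<open>\<beta> = 0\<close> the term \<open>- \<Psi> x = ln (- x)\<close> grows.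
\<close>

lemma conjugate_Psi_base_infinite:
  assumes DE: "(D, E) \<in> base_domains \<beta>" and "y \<notin> D"
  shows "conjugate (extend E (Psi_val \<beta>)) y = \<infinity>"
  using DE
proof (cases rule: base_domains_cases)
  case entropy
  show ?thesis
  proof (rule conjugate_extend_infinite)
    have "filterlim (\<lambda>t::real. - t * y - exp (- t)) at_top at_top"
      using entropy \<open>y \<notin> D\<close> by simp real_asymp
    then show "filterlim (\<lambda>t. - t * y - Psi_val \<beta> (- t)) at_top at_top"
      using entropy by (simp add: Psi_val_def)
  qed (use entropy in auto)
next
  case (power s)
  have s: "s = 1 \<or> s = -1"
    using power by linarith
  show ?thesis
  proof (rule conjugate_extend_infinite)
    let ?C = "\<bar>\<beta> - 1\<bar> powr (\<beta> / (\<beta> - 1)) / \<beta>"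
    have y: "0 < - s * y"
      using power \<open>y \<notin> D\<close> by auto
    have "filterlim (\<lambda>t::real. (- s * y) * t - ?C) at_top at_top"
      using y by real_asymp
    then show "filterlim (\<lambda>t. - s * t * y - Psi_val \<beta> (- s * t)) at_top at_top"
    proof (rule filterlim_at_top_mono)
      have "(- s * y) * t - ?C \<le> - s * t * y - Psi_val \<beta> (- s * t)" if "1 \<le> t" for t
      proof -
        have "Psi_val \<beta> (- s * t) = \<bar>(\<beta> - 1) * t\<bar> powr (\<beta> / (\<beta> - 1)) / \<beta>"
          using power that s by (subst Psi_val_power) (auto simp: abs_mult mult_nonpos_nonneg)
        also have "\<dots> \<le> ?C"
        proof (intro divide_right_mono powr_mono2')
          show "\<bar>\<beta> - 1\<bar> \<le> \<bar>(\<beta> - 1) * t\<bar>"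
            using that mult_left_mono[of 1 t "\<bar>\<beta> - 1\<bar>"] by (simp add: abs_mult)
        qed (use power in \<open>auto simp: divide_nonneg_neg\<close>)
        finally show ?thesis
          by (simp add: algebra_simps)
      qed
      then show "\<forall>\<^sub>F t in at_top. (- s * y) * t - ?C \<le> - s * t * y - Psi_val \<beta> (- s * t)"
        using eventually_ge_at_top[of 1] by (rule eventually_mono[rotated])
    qed
    show "\<forall>\<^sub>F t in at_top. - s * t \<in> E"
      using eventually_gt_at_top[of 0] by eventually_elim (use power s in auto)
  qed simp
next
  case log
  show ?thesis
  proof (rule conjugate_extend_infinite)
    have "filterlim (\<lambda>t::real. ln t) at_top at_top"
      by real_asymp
    then show "filterlim (\<lambda>t. - t * y - Psi_val \<beta> (- t)) at_top at_top"
    proof (rule filterlim_at_top_mono)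
      show "\<forall>\<^sub>F t in at_top. ln t \<le> - t * y - Psi_val \<beta> (- t)"
        using eventually_ge_at_top[of 0]
        by eventually_elim (use log \<open>y \<notin> D\<close> in \<open>auto simp: Psi_val_def mult_nonneg_nonpos\<close>)
    qed
    show "\<forall>\<^sub>F t in at_top. - t \<in> E"
      using eventually_gt_at_top[of 0] by eventually_elim (use log in auto)
  qed simp
qed (use \<open>y \<notin> D\<close> in auto)

section \<open>Moments from the moment generating function\<close>

lemma abs_exp_minus_one_le: "\<bar>exp u - 1\<bar> \<le> \<bar>u\<bar> * exp \<bar>u :: real\<bar>"
proof (cases "0 \<le> u")
  case True
  have "exp u * (1 + - u) \<le> exp u * exp (- u)"
    by (intro mult_left_mono exp_ge_add_one_self) simp
  then show ?thesis
    using True by (simp add: algebra_simps exp_minus)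
next
  case False
  then have "\<bar>exp u - 1\<bar> = 1 - exp u"
    by simp
  also have "\<dots> \<le> \<bar>u\<bar>"
    using False exp_ge_add_one_self[of u] by linarith
  also have "\<dots> \<le> \<bar>u\<bar> * exp \<bar>u\<bar>"
    using mult_left_mono[of 1 "exp \<bar>u\<bar>" "\<bar>u\<bar>"] by simp
  finally show ?thesis .
qed

lemma abs_le_exp:
  fixes b e :: real
  assumes "0 < e"
  shows "\<bar>b\<bar> \<le> exp (e * \<bar>b\<bar>) / e"
proof -
  have "e * \<bar>b\<bar> \<le> exp (e * \<bar>b\<bar>)"
    using exp_ge_add_one_self[of "e * \<bar>b\<bar>"] by linarith
  then show ?thesis
    using assms by (simp add: field_simps)
qed

lemma exp_abs_le: "exp (e * \<bar>b\<bar>) \<le> exp (e * b) + exp (- e * b)" for b e :: real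
  by (cases "0 \<le> b") (auto simp: abs_real_def)

text \<open>
  Integrating \<open>exp (y * b) \<ge> exp (x * b) * (1 + (y - x) * b)\<close> gives an affine minorant of the generating
  function that touches it at \<open>x\<close>; its slope, the mean of \<open>b * exp (x * b)\<close>, must be the derivative
  \<open>M' x\<close>.  The difference quotients of these slopes at \<open>0\<close> converge to the second moment by dominated
  convergence.
\<close>

lemma moments_of_mgf:
  fixes P :: "real measure" and M' :: "real \<Rightarrow> real"
  assumes meas: "(\<lambda>b. b) \<in> borel_measurable P" and r: "0 < r"
    and int: "\<And>x. \<bar>x\<bar> < r \<Longrightarrow> integrable P (\<lambda>b. exp (x * b))"
    and M': "\<And>x. \<bar>x\<bar> < r \<Longrightarrow>
      ((\<lambda>x. \<integral>b. exp (x * b) \<partial>P) has_real_derivative M' x) (at x)"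
    and d: "(M' has_real_derivative d) (at 0)"
  shows "integrable P (\<lambda>b. b)" "(\<integral>b. b \<partial>P) = M' 0"
    "integrable P (\<lambda>b. b\<^sup>2)" "(\<integral>b. b\<^sup>2 \<partial>P) = d"
proof -
  note [measurable] = meas
  have int1: "integrable P (\<lambda>b. b * exp (x * b))" if x: "\<bar>x\<bar> < r" for x
  proof -
    define e where "e = (r - \<bar>x\<bar>) / 2"
    have e: "0 < e" "\<bar>x + e\<bar> < r" "\<bar>x - e\<bar> < r"
      using x by (auto simp: e_def field_simps abs_real_def)
    have "integrable P (\<lambda>b. (exp ((x + e) * b) + exp ((x - e) * b)) / e)"
      using int[OF e(2)] int[OF e(3)] by (simp add: integrable_add)
    then show ?thesis
    proof (rule Bochner_Integration.integrable_bound)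
      have "norm (b * exp (x * b)) \<le> norm ((exp ((x + e) * b) + exp ((x - e) * b)) / e)" for b
      proof -
        have "\<bar>b\<bar> \<le> (exp (e * b) + exp (- e * b)) / e"
          using abs_le_exp[OF e(1), of b] divide_right_mono[OF exp_abs_le[of e b], of e] e(1)
          by linarith
        then have "\<bar>b\<bar> * exp (x * b) \<le> (exp (e * b) + exp (- e * b)) / e * exp (x * b)"
          by (intro mult_right_mono) auto
        also have "\<dots> = (exp ((x + e) * b) + exp ((x - e) * b)) / e"
          by (simp add: field_simps exp_add[symmetric])
        finally show ?thesis
          using e(1) by (simp add: abs_mult)
      qed
      then show "AE b in P. norm (b * exp (x * b)) \<le> norm ((exp ((x + e) * b) + exp ((x - e) * b)) / e)"
        by simp
    qed simp
  qed
  have M'_eq: "M' x = (\<integral>b. b * exp (x * b) \<partial>P)" if x: "\<bar>x\<bar> < r" for x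
  proof -
    let ?M = "\<lambda>x. \<integral>b. exp (x * b) \<partial>P" and ?N = "\<integral>b. b * exp (x * b) \<partial>P"
    have le: "?M x + (y - x) * ?N \<le> ?M y" if y: "\<bar>y\<bar> < r" for y
    proof -
      have "exp (x * b) + (y - x) * (b * exp (x * b)) \<le> exp (y * b)" for b
      proof -
        have "exp (x * b) * (1 + (y - x) * b) \<le> exp (x * b) * exp ((y - x) * b)"
          by (intro mult_left_mono exp_ge_add_one_self) auto
        then show ?thesis
          by (simp add: algebra_simps exp_add[symmetric])
      qed
      then have "(\<integral>b. exp (x * b) + (y - x) * (b * exp (x * b)) \<partial>P) \<le> ?M y"
        using int[OF x] int1[OF x] int[OF y] by (intro integral_mono) auto
      then show ?thesis
        using int[OF x] int1[OF x] by simp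
    qed
    have "((\<lambda>y. ?M y - (?M x + (y - x) * ?N)) has_real_derivative M' x - ?N) (at x)"
      using M'[OF x] by (auto intro!: derivative_eq_intros)
    moreover have "\<forall>y. \<bar>x - y\<bar> < r - \<bar>x\<bar> \<longrightarrow>
        ?M x - (?M x + (x - x) * ?N) \<le> ?M y - (?M x + (y - x) * ?N)"
    proof (intro allI impI)
      fix y assume "\<bar>x - y\<bar> < r - \<bar>x\<bar>"
      then have "\<bar>y\<bar> < r"
        by linarith
      then show "?M x - (?M x + (x - x) * ?N) \<le> ?M y - (?M x + (y - x) * ?N)"
        using le[of y] by simp
    qed
    ultimately have "M' x - ?N = 0"
      using x by (intro DERIV_local_min[of "\<lambda>y. ?M y - (?M x + (y - x) * ?N)"]) auto
    then show ?thesis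
      by simp
  qed
  show "integrable P (\<lambda>b. b)" "(\<integral>b. b \<partial>P) = M' 0"
    using int1[of 0] M'_eq[of 0] r by auto

  (* the dominating function contains exp (3 * e * b) and exp (- 3 * e * b), so 3 * e must be below r *)
  define e where "e = r / 4"
  have e: "0 < e" "3 * e < r"
    using r by (auto simp: e_def)
  define h where "h n = e / real (Suc n)" for n
  have h: "h n \<noteq> 0" "\<bar>h n\<bar> \<le> e" for n
    using e by (auto simp: h_def field_simps)
  have "h \<longlonglongrightarrow> 0"
    unfolding h_def[abs_def] by (intro LIMSEQ_Suc lim_const_over_n)
  then have h0: "filterlim h (at 0) sequentially"
    using h(1) by (simp add: filterlim_at)
  let ?g = "\<lambda>n b. (b * exp (h n * b) - b) / h n"
  let ?w = "\<lambda>b. (exp ((3 * e) * b) + exp (- (3 * e) * b)) / e\<^sup>2"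
  have bound: "\<bar>?g n b\<bar> \<le> ?w b" for n b
  proof -
    have "exp \<bar>h n * b\<bar> \<le> exp (e * \<bar>b\<bar>)"
      using h(2)[of n] by (simp add: abs_mult mult_right_mono)
    then have "\<bar>exp (h n * b) - 1\<bar> \<le> \<bar>h n * b\<bar> * exp (e * \<bar>b\<bar>)"
      using abs_exp_minus_one_le[of "h n * b"] mult_left_mono[of _ _ "\<bar>h n * b\<bar>"]
      by (meson abs_ge_zero order_trans)
    then have "\<bar>b\<bar> * \<bar>exp (h n * b) - 1\<bar> \<le> \<bar>b\<bar> * (\<bar>h n * b\<bar> * exp (e * \<bar>b\<bar>))"
      by (intro mult_left_mono) auto
    then have "\<bar>b\<bar> * \<bar>exp (h n * b) - 1\<bar> / \<bar>h n\<bar> \<le> \<bar>b\<bar> * \<bar>b\<bar> * exp (e * \<bar>b\<bar>)"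
      using h(1)[of n] by (simp add: field_simps abs_mult del: abs_mult_self_eq)
    also have "\<bar>b\<bar> * \<bar>b\<bar> * exp (e * \<bar>b\<bar>)
        \<le> exp (e * \<bar>b\<bar>) / e * (exp (e * \<bar>b\<bar>) / e) * exp (e * \<bar>b\<bar>)"
      using abs_le_exp[OF e(1), of b] by (intro mult_mono) (use e(1) in auto)
    also have "\<dots> = exp (3 * e * \<bar>b\<bar>) / e\<^sup>2"
      by (simp add: power2_eq_square exp_add[symmetric])
    also have "\<dots> \<le> ?w b"
      using exp_abs_le[of "3 * e" b] by (intro divide_right_mono) auto
    finally have "\<bar>b\<bar> * \<bar>exp (h n * b) - 1\<bar> / \<bar>h n\<bar> \<le> ?w b" .
    moreover have "?g n b = b * (exp (h n * b) - 1) / h n"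
      by (simp add: algebra_simps)
    ultimately show ?thesis
      by (simp only: abs_mult abs_divide)
  qed
  have lim: "(\<lambda>n. ?g n b) \<longlonglongrightarrow> b\<^sup>2" for b
  proof -
    have "((\<lambda>x. b * exp (x * b)) has_real_derivative b\<^sup>2) (at 0)"
      by (auto intro!: derivative_eq_intros simp: power2_eq_square)
    then have "((\<lambda>x. (b * exp (x * b) - b) / x) \<longlongrightarrow> b\<^sup>2) (at 0)"
      by (simp add: DERIV_def)
    from filterlim_compose[OF this h0] show ?thesis .
  qed
  have w: "integrable P ?w"
    using int[of "3 * e"] int[of "- (3 * e)"] e by (intro integrable_divide integrable_add) auto
  have dom: "AE b in P. (\<lambda>n. ?g n b) \<longlonglongrightarrow> b\<^sup>2" "\<And>n. AE b in P. norm (?g n b) \<le> ?w b"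
    using lim bound by auto
  have ms: "(\<lambda>b. b\<^sup>2) \<in> borel_measurable P" "\<And>n. ?g n \<in> borel_measurable P"
    by measurable
  show "integrable P (\<lambda>b. b\<^sup>2)"
    by (rule integrable_dominated_convergence[OF ms w dom])
  have g_lim: "(\<lambda>n. \<integral>b. ?g n b \<partial>P) \<longlonglongrightarrow> (\<integral>b. b\<^sup>2 \<partial>P)"
    by (rule integral_dominated_convergence[OF ms w dom])
  have g_eq: "(\<lambda>n. \<integral>b. ?g n b \<partial>P) = (\<lambda>n. (M' (0 + h n) - M' 0) / h n)"
  proof
    fix n
    have "\<bar>h n\<bar> < r"
      using h(2)[of n] e by linarith
    then show "(\<integral>b. ?g n b \<partial>P) = (M' (0 + h n) - M' 0) / h n"
      using int1[of "h n"] int1[of 0] M'_eq[of "h n"] M'_eq[of 0] r by simp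
  qed
  have "(\<lambda>n. (M' (0 + h n) - M' 0) / h n) \<longlonglongrightarrow> d"
    using filterlim_compose[OF d[unfolded DERIV_def] h0] .
  then show "(\<integral>b. b\<^sup>2 \<partial>P) = d"
    using LIMSEQ_unique[OF g_lim] unfolding g_eq by blast
qed

section \<open>Exponential families\<close>

text \<open>
  If \<open>h b * exp ((b * \<theta> - F \<theta>) / s)\<close> is a probability density for every \<open>\<theta> \<in> E\<close>, then tilting by
  \<open>exp (x * b)\<close> shifts \<open>\<theta>\<close> by \<open>x * s\<close>, so that the moment generating function is a quotient of two
  normalizing constants.
\<close>

locale exponential_family =
  fixes \<nu> :: "real measure" and B E :: "real set" and h F q v :: "real \<Rightarrow> real" and s :: real
  assumes B: "B \<in> sets \<nu>" and id: "(\<lambda>b. b) \<in> borel_measurable \<nu>"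
    and E: "open E" and s: "0 < s"
    and h: "h \<in> borel_measurable (restrict_space \<nu> B)" "\<And>b. b \<in> B \<Longrightarrow> 0 \<le> h b"
    and normalized: "\<And>\<theta>. \<theta> \<in> E \<Longrightarrow>
      (\<integral>\<^sup>+b\<in>B. ennreal (h b * exp ((b * \<theta> - F \<theta>) / s)) \<partial>\<nu>) = 1"
    and F: "\<And>\<theta>. \<theta> \<in> E \<Longrightarrow> (F has_real_derivative q \<theta>) (at \<theta>)"
    and q: "\<And>\<theta>. \<theta> \<in> E \<Longrightarrow> (q has_real_derivative v \<theta>) (at \<theta>)"
begin

definition dens :: "real \<Rightarrow> real \<Rightarrow> real" where
  "dens \<theta> b = h b * exp ((b * \<theta> - F \<theta>) / s)"

lemma id_restrict [measurable]: "(\<lambda>b. b) \<in> borel_measurable (restrict_space \<nu> B)"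
  using id by (rule measurable_restrict_space1)

lemma dens_measurable [measurable]: "dens \<theta> \<in> borel_measurable (restrict_space \<nu> B)"
  unfolding dens_def[abs_def] using h(1) by measurable

lemma space_B: "space (restrict_space \<nu> B) = B"
  using sets.sets_into_space[OF B] by (auto simp: space_restrict_space)

lemma dens_nonneg: "b \<in> B \<Longrightarrow> 0 \<le> dens \<theta> b"
  by (simp add: dens_def h(2))

lemma nn_integral_dens: "\<theta> \<in> E \<Longrightarrow> (\<integral>\<^sup>+b. ennreal (dens \<theta> b) \<partial>restrict_space \<nu> B) = 1"
  using normalized[of \<theta>] B by (simp add: nn_integral_restrict_space dens_def)

lemma is_pdf_dens: "\<theta> \<in> E \<Longrightarrow> is_pdf \<nu> B (dens \<theta>)"
  using normalized[of \<theta>] dens_nonneg by (simp add: is_pdf_def) (simp add: dens_def)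

lemma prob_space_law: "\<theta> \<in> E \<Longrightarrow> prob_space (law \<nu> B (dens \<theta>))"
  by (rule prob_spaceI)
    (simp add: law_def emeasure_density nn_integral_dens cong: nn_integral_cong)

lemma has_bochner_integral_exp:
  assumes \<theta>: "\<theta> \<in> E" and x: "\<theta> + x * s \<in> E"
  shows "has_bochner_integral (law \<nu> B (dens \<theta>)) (\<lambda>b. exp (x * b))
    (exp ((F (\<theta> + x * s) - F \<theta>) / s))"
proof (rule has_bochner_integral_nn_integral)
  let ?c = "exp ((F (\<theta> + x * s) - F \<theta>) / s)"
  have *: "dens \<theta> b * exp (x * b) = ?c * dens (\<theta> + x * s) b" for b
    using s by (simp add: dens_def exp_add[symmetric] field_simps)
  have "(\<integral>\<^sup>+b. ennreal (exp (x * b)) \<partial>law \<nu> B (dens \<theta>))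
      = (\<integral>\<^sup>+b. ennreal (dens \<theta> b) * ennreal (exp (x * b)) \<partial>restrict_space \<nu> B)"
    unfolding law_def by (rule nn_integral_density) measurable
  also have "\<dots> = (\<integral>\<^sup>+b. ennreal ?c * ennreal (dens (\<theta> + x * s) b) \<partial>restrict_space \<nu> B)"
    by (intro nn_integral_cong) (simp add: space_B dens_nonneg * flip: ennreal_mult')
  also have "\<dots> = ennreal ?c"
    by (simp add: nn_integral_cmult nn_integral_dens[OF x])
  finally show "(\<integral>\<^sup>+b. ennreal (exp (x * b)) \<partial>law \<nu> B (dens \<theta>)) = ennreal ?c" .
qed (auto simp: law_def)

lemma eventually_shift_in_E:
  assumes "\<theta> \<in> E"
  obtains r where "0 < r" "\<And>x. \<bar>x\<bar> < r \<Longrightarrow> \<theta> + x * s \<in> E"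
proof -
  obtain d where d: "0 < d" "ball \<theta> d \<subseteq> E"
    using E assms by (meson open_contains_ball)
  show thesis
  proof (rule that[of "d / s"])
    fix x assume "\<bar>x\<bar> < d / s"
    then have "dist \<theta> (\<theta> + x * s) < d"
      using s by (simp add: dist_real_def abs_mult field_simps)
    then show "\<theta> + x * s \<in> E"
      using d(2) by auto
  qed (use d s in simp)
qed

lemma moments:
  assumes \<theta>: "\<theta> \<in> E"
  defines "P \<equiv> law \<nu> B (dens \<theta>)"
  shows "integrable P (\<lambda>b. b)" "(\<integral>b. b \<partial>P) = q \<theta>"
    "integrable P (\<lambda>b. b\<^sup>2)" "(\<integral>b. b\<^sup>2 \<partial>P) = s * v \<theta> + (q \<theta>)\<^sup>2"
proof -
  obtain r where r: "0 < r" "\<And>x. \<bar>x\<bar> < r \<Longrightarrow> \<theta> + x * s \<in> E"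
    using eventually_shift_in_E[OF \<theta>] by metis
  let ?M = "\<lambda>x. exp ((F (\<theta> + x * s) - F \<theta>) / s)"
  let ?M' = "\<lambda>x. ?M x * q (\<theta> + x * s)"
  have int: "has_bochner_integral P (\<lambda>b. exp (x * b)) (?M x)" if "\<bar>x\<bar> < r" for x
    unfolding P_def by (rule has_bochner_integral_exp[OF \<theta> r(2)[OF that]])
  have shift: "((\<lambda>x. \<theta> + x * s) has_real_derivative s) (at x)" for x
    by (auto intro!: derivative_eq_intros)
  have dM: "(?M has_real_derivative ?M' x) (at x)" if "\<bar>x\<bar> < r" for x
    using s DERIV_chain2[OF F[OF r(2)[OF that]] shift]
    by (auto intro!: derivative_eq_intros)
  have mgf: "((\<lambda>x. \<integral>b. exp (x * b) \<partial>P) has_real_derivative ?M' x) (at x)" if x: "\<bar>x\<bar> < r" for x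
    using int x
    by (intro deriv_eq_on_open[OF _ _ _ dM[OF x], of "{-r<..<r}"])
       (auto simp: has_bochner_integral_iff abs_less_iff)
  have "(?M' has_real_derivative ?M' 0 * q \<theta> + v \<theta> * s * ?M 0) (at 0)"
    using DERIV_mult[OF dM[of 0] DERIV_chain2[OF q[OF r(2)[of 0]] shift[of 0]]] r(1)
    by (simp add: algebra_simps)
  then have "(?M' has_real_derivative s * v \<theta> + (q \<theta>)\<^sup>2) (at 0)"
    by (simp add: power2_eq_square algebra_simps)
  from moments_of_mgf[OF _ r(1) _ mgf this]
  show "integrable P (\<lambda>b. b)" "(\<integral>b. b \<partial>P) = q \<theta>"
    "integrable P (\<lambda>b. b\<^sup>2)" "(\<integral>b. b\<^sup>2 \<partial>P) = s * v \<theta> + (q \<theta>)\<^sup>2"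
    using int by (auto simp: has_bochner_integral_iff P_def law_def)
qed

lemma variance:
  assumes \<theta>: "\<theta> \<in> E"
  shows "prob_space.variance (law \<nu> B (dens \<theta>)) (\<lambda>b. b) = s * v \<theta>"
proof -
  interpret prob_space "law \<nu> B (dens \<theta>)"
    using prob_space_law[OF \<theta>] .
  show ?thesis
    using variance_eq[OF moments(1,3)[OF \<theta>]] moments(2,4)[OF \<theta>] by simp
qed

lemma cgf_eventually:
  assumes \<theta>: "\<theta> \<in> E"
  shows "\<forall>\<^sub>F x in nhds 0. integrable (law \<nu> B (dens \<theta>)) (\<lambda>b. exp (x * b)) \<and>
    cgf (law \<nu> B (dens \<theta>)) x = (F (\<theta> + x * s) - F \<theta>) / s"
proof -
  obtain r where r: "0 < r" "\<And>x. \<bar>x\<bar> < r \<Longrightarrow> \<theta> + x * s \<in> E"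
    using eventually_shift_in_E[OF \<theta>] by metis
  have "integrable (law \<nu> B (dens \<theta>)) (\<lambda>b. exp (x * b)) \<and>
    cgf (law \<nu> B (dens \<theta>)) x = (F (\<theta> + x * s) - F \<theta>) / s" if "x \<in> {-r<..<r}" for x
    using has_bochner_integral_exp[OF \<theta> r(2)[of x]] that
    by (auto simp: has_bochner_integral_iff cgf_def abs_less_iff)
  then show ?thesis
    using r(1) eventually_nhds_in_open[of "{-r<..<r}" 0] by (auto elim: eventually_mono)
qed

text \<open>A mean outside the convex hull of the observations would lie strictly on one side of all of them.\<close>

lemma mean_in_convex_hull:
  assumes \<theta>: "\<theta> \<in> E"
  shows "q \<theta> \<in> convex hull B"
proof (rule ccontr)
  assume n: "q \<theta> \<notin> convex hull B"
  interpret prob_space "law \<nu> B (dens \<theta>)"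
    using prob_space_law[OF \<theta>] .
  have sp: "space (law \<nu> B (dens \<theta>)) = B"
    by (simp add: law_def space_B)
  have "(\<forall>b\<in>B. b < q \<theta>) \<or> (\<forall>b\<in>B. q \<theta> < b)"
  proof (rule ccontr)
    assume "\<not> ?thesis"
    then obtain a b where "a \<in> convex hull B" "b \<in> convex hull B" "a \<le> q \<theta>" "q \<theta> \<le> b"
      by (meson hull_inc linorder_not_less)
    then have "q \<theta> \<in> convex hull B"
      using convex_convex_hull[of B] unfolding is_interval_convex_1[symmetric] is_interval_1 by blast
    with n show False ..
  qed
  then have "expectation (\<lambda>b. b) < q \<theta> \<or> q \<theta> < expectation (\<lambda>b. b)"
    using expectation_less[OF moments(1)[OF \<theta>] AE_I2, of "q \<theta>"]
      expectation_greater[OF moments(1)[OF \<theta>] AE_I2, of "q \<theta>"]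
    by (auto simp: sp)
  then show False
    using moments(2)[OF \<theta>] by simp
qed

end

section \<open>The domains forced by membership in the Legendre class\<close>

lemma Phi_val_half_line_derivative:
  assumes "0 \<le> \<beta>" "\<beta> \<le> 1"
  shows "\<And>x. 0 < x \<Longrightarrow> (Phi_val \<beta> has_real_derivative grad_Phi \<beta> x) (at x)"
    "continuous_on {0<..} (grad_Phi \<beta>)"
    "\<beta> \<noteq> 0 \<Longrightarrow> continuous_on {0..} (Phi_val \<beta>)"
proof -
  obtain D E where DE: "(D, E) \<in> base_domains \<beta>" "interior D = {0<..}" "\<beta> \<noteq> 0 \<Longrightarrow> D = {0..}"
  proof -
    consider "\<beta> = 0" | "\<beta> = 1" | "0 < \<beta>" "\<beta> < 1"
      using assms by linarith
    then show thesis
    proof cases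
      case 1
      then show ?thesis
        by (intro that[of "{0<..}" "{..<0}"]) (auto simp: base_domains_def interior_open)
    next
      case 2
      then show ?thesis
        by (intro that[of "{0..}" UNIV]) (auto simp: base_domains_def)
    next
      case 3
      then show ?thesis
        by (intro that[of "{0..}" "{..<0}"]) (auto simp: base_domains_def)
    qed
  qed
  interpret smooth_convex D "Phi_val \<beta>" "grad_Phi \<beta>"
    using smooth_convex_Phi[OF DE(1)] .
  show "\<And>x. 0 < x \<Longrightarrow> (Phi_val \<beta> has_real_derivative grad_Phi \<beta> x) (at x)"
    "continuous_on {0<..} (grad_Phi \<beta>)" "\<beta> \<noteq> 0 \<Longrightarrow> continuous_on {0..} (Phi_val \<beta>)"
    using deriv cont_deriv cont DE by auto
qed

lemma strictly_convex_on_midpoint: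
  assumes "strictly_convex_on S F" "x \<in> S" "y \<in> S" "x \<noteq> y"
  shows "F ((x + y) / 2) < (F x + F y) / 2"
proof -
  have "F ((1 - 1/2) * x + 1/2 * y) < (1 - 1/2) * F x + 1/2 * F y"
    using assms(1)[unfolded strictly_convex_on_def, THEN conjunct2, rule_format,
        OF assms(2,3), of "1/2"] assms(4) by simp
  then show ?thesis
    by (simp add: field_simps)
qed

text \<open>
  Steepness lets the domain end only at \<open>0\<close>, and lower semicontinuity adds the endpoint \<open>0\<close> when
  \<open>\<beta> > 0\<close>.  For \<open>0 < \<beta> < 1\<close> the formula is nonpositive on \<open>{0..}\<close> and is, up to sign, even, so it
  cannot be strictly convex across \<open>0\<close>; on the negative half-line it is convex for even exponents
  and concave for odd ones.
\<close>

lemma legendre_Phi_domain: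
  assumes beta: "\<beta> \<in> {0..1} \<or> \<beta> \<in> {1<..2} \<inter> R_even" and f: "legendre f"
    and val: "\<And>x. x \<in> edom f \<Longrightarrow> Phi_defined \<beta> x \<and> f x = ereal (Phi_val \<beta> x)"
  shows "\<exists>E. (edom f, E) \<in> base_domains \<beta>"
proof -
  have feq: "f x = ereal (Phi_val \<beta> x)" if "x \<in> edom f" for x
    using val[OF that] by blast
  have ne: "\<exists>y\<in>edom f. y \<noteq> 0"
  proof (rule ccontr)
    assume "\<not> ?thesis"
    then have "interior (edom f) \<subseteq> interior {0}"
      by (intro interior_mono) auto
    then show False
      using f by (auto simp: legendre_def)
  qed
  show ?thesis
  proof (cases "1 < \<beta>")
    case True
    then have "(UNIV, UNIV) \<in> base_domains \<beta>"
      using beta by (auto simp: base_domains_def)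
    then interpret smooth_convex UNIV "Phi_val \<beta>" "grad_Phi \<beta>"
      by (rule smooth_convex_Phi)
    have "UNIV \<subseteq> edom f"
      using legendre_contains_smooth_component[OF f feq, of UNIV "grad_Phi \<beta>"] deriv cont_deriv ne
      by auto
    then show ?thesis
      using \<open>(UNIV, UNIV) \<in> base_domains \<beta>\<close> by (metis top.extremum_uniqueI)
  next
    case False
    then have b: "0 \<le> \<beta>" "\<beta> \<le> 1"
      using beta by auto
    note hl = Phi_val_half_line_derivative[OF b]
    have pos: "{0<..} \<subseteq> edom f" if "y \<in> edom f" "0 < y" for y
      using legendre_contains_smooth_component[OF f feq, of "{0<..}" "grad_Phi \<beta>"] hl(1,2) that
      by auto
    have zero: "0 \<in> edom f" if "\<beta> \<noteq> 0" "{0<..} \<subseteq> edom f"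
    proof (rule legendre_contains_limit[OF f feq that(2)])
      have "(Phi_val \<beta> \<longlongrightarrow> Phi_val \<beta> 0) (at 0 within {0..})"
        using hl(3)[OF that(1)] by (simp add: continuous_on_def)
      then show "(Phi_val \<beta> \<longlongrightarrow> Phi_val \<beta> 0) (at 0 within {0<..})"
        by (rule tendsto_within_subset) auto
    qed (auto simp: trivial_limit_at_right_real)
    consider "\<beta> = 0" | "\<beta> = 1" | "0 < \<beta>" "\<beta> < 1"
      using b by linarith
    then show ?thesis
    proof cases
      case 1
      then have "edom f = {0<..}"
        using val pos ne by (force simp: Phi_defined_def)
      then show ?thesis
        using 1 by (auto simp: base_domains_def)
    next
      case 2
      then have nn: "0 \<le> x" if "x \<in> edom f" for x
        using val[OF that] by (simp add: Phi_defined_def)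
      then have "{0<..} \<subseteq> edom f"
        using pos ne by force
      then have "edom f = {0..}"
        using nn zero 2 by (force simp: le_less)
      then show ?thesis
        using 2 by (auto simp: base_domains_def)
    next
      case 3
      define G where "G x = \<bar>x\<bar> powr \<beta> / (\<beta> * (\<beta> - 1))" for x
      interpret G: smooth_convex "{..0}" G "grad_Phi \<beta>"
        using power_pair_halfline(1)[OF 3, of "-1"] by (simp add: G_def[abs_def] atMost_def)
      define c :: real where "c = (if \<beta> \<in> R_even then 1 else -1)"
      have neg_val: "Phi_val \<beta> x = c * G x" if "x \<in> edom f" "x < 0" for x
        using val[OF that(1)] that(2) 3
        by (auto simp: Phi_defined_def rpow_defined_def Phi_val_def rpow_def G_def c_def)
      have neg_val': "Phi_val \<beta> x = c * G x" if "y \<in> edom f" "y < 0" "x < 0" for x y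
        using val[OF that(1)] that(2,3) 3
        by (auto simp: Phi_defined_def rpow_defined_def Phi_val_def rpow_def G_def c_def)
      have neg: "{..<0} \<subseteq> edom f" if y: "y \<in> edom f" "y < 0" for y
      proof (rule legendre_contains_smooth_component[OF f feq, of "{..<0}" "\<lambda>x. c * grad_Phi \<beta> x"])
        fix u :: real assume u: "u \<in> {..<0}"
        have "((\<lambda>x. c * G x) has_real_derivative c * grad_Phi \<beta> u) (at u)"
          using u by (intro DERIV_cmult G.deriv) auto
        then show "(Phi_val \<beta> has_real_derivative c * grad_Phi \<beta> u) (at u)"
          using neg_val'[OF y] u by (intro deriv_eq_on_open[of "{..<0}" u "Phi_val \<beta>"]) auto
      qed (use y G.cont_deriv in \<open>auto intro!: continuous_intros\<close>)
      have sc: "strictly_convex_on (interior (edom f)) (fin f)"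
        using f by (auto simp: legendre_def)
      have finf: "fin f x = Phi_val \<beta> x" if "x \<in> edom f" for x
        using feq[OF that] by (simp add: fin_def)
      have not_both: False if "{0<..} \<subseteq> edom f" "{..<0} \<subseteq> edom f"
      proof -
        have "x \<in> edom f" for x
          using that zero 3 by (cases x "0::real" rule: linorder_cases) auto
        then have U: "edom f = UNIV"
          by auto
        have "fin f ((-1 + 1) / 2) < (fin f (-1) + fin f 1) / 2"
          using sc by (rule strictly_convex_on_midpoint) (auto simp: U)
        then have "0 < Phi_val \<beta> (-1) + Phi_val \<beta> 1"
          using 3 finf by (simp add: U Phi_val_def[of \<beta> 0] rpow_def)
        moreover have "Phi_val \<beta> (-1) = c * G (-1)"
          by (rule neg_val) (auto simp: U)
        moreover have "Phi_val \<beta> 1 = G 1" "G (-1) = G 1" "G 1 < 0"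
          using 3 by (auto simp: Phi_val_def rpow_def G_def mult_pos_neg)
        ultimately show False
          by (auto simp: c_def split: if_splits)
      qed
      show ?thesis
      proof (cases "\<exists>y\<in>edom f. 0 < y")
        case True
        then have "{0<..} \<subseteq> edom f"
          using pos by auto
        moreover from this have "0 \<le> x" if "x \<in> edom f" for x
          using neg[OF that] not_both by force
        ultimately have "edom f = {0..}"
          using zero 3 by (force simp: le_less)
        then show ?thesis
          using 3 by (auto simp: base_domains_def)
      next
        case False
        then have np: "x \<le> 0" if "x \<in> edom f" for x
          using that by force
        then obtain y where y: "y \<in> edom f" "y < 0"
          using ne by force
        have sub: "{..<0} \<subseteq> edom f"
          using neg[OF y] .
        have "0 \<in> edom f"
        proof (rule legendre_contains_limit[OF f feq sub])
          have "(G \<longlongrightarrow> G 0) (at 0 within {..0})"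
            using G.cont by (simp add: continuous_on_def)
          then have "(G \<longlongrightarrow> G 0) (at 0 within {..<0})"
            by (rule tendsto_within_subset) auto
          then have "((\<lambda>x. c * G x) \<longlongrightarrow> c * G 0) (at 0 within {..<0})"
            by (rule tendsto_mult_left)
          moreover have "c * G x = Phi_val \<beta> x" if "x < 0" for x
            using neg_val[of x] sub that by auto
          ultimately show "(Phi_val \<beta> \<longlongrightarrow> c * G 0) (at 0 within {..<0})"
            by (elim Lim_transform_eventually) (auto simp: eventually_at_filter)
        qed (auto simp: trivial_limit_at_left_real)
        then have D: "edom f = {..0}"
          using np sub by (force simp: le_less)
        have "c = 1"
        proof (rule ccontr)
          assume "c \<noteq> 1"
          then have "c = -1"
            by (simp add: c_def split: if_splits)
          have "fin f ((-1 + -2) / 2) < (fin f (-1) + fin f (-2)) / 2"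
            using sc by (rule strictly_convex_on_midpoint) (auto simp: D)
          moreover have "G ((-1 + -2) / 2) < (G (-1) + G (-2)) / 2"
            using G.strictly_convex by (rule strictly_convex_on_midpoint) auto
          moreover have "fin f x = - G x" if "x < 0" for x
            using neg_val[of x] finf[of x] that by (simp add: D \<open>c = -1\<close>)
          ultimately show False
            by simp
        qed
        then have "\<beta> \<in> R_even"
          by (simp add: c_def split: if_splits)
        then show ?thesis
          using D 3 by (auto simp: base_domains_def)
      qed
    qed
  qed
qed

lemma base_functions_extend:
  assumes "base_functions \<beta> \<Phi> \<Psi>" "legendre \<Phi>" "legendre \<Psi>" "(edom \<Phi>, E) \<in> base_domains \<beta>"
  shows "\<Phi> = extend (edom \<Phi>) (Phi_val \<beta>)" "\<Psi> = extend E (Psi_val \<beta>)"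
proof -
  show Phi: "\<Phi> = extend (edom \<Phi>) (Phi_val \<beta>)"
  proof
    fix x show "\<Phi> x = extend (edom \<Phi>) (Phi_val \<beta>) x"
      using assms(1) by (cases "x \<in> edom \<Phi>") (auto simp: base_functions_def extend_def edom_def)
  qed
  obtain c where "conjugate \<Phi> x = \<Psi> x + ereal c" for x
    using assms(1) by (auto simp: base_functions_def)
  then have c: "\<Psi> x + ereal c = extend E (Psi_val \<beta>) x + ereal (if \<beta> = 0 then -1 else 0)" for x
    using conjugate_Phi_base[OF assms(4), of x] Phi by simp
  have "\<Psi> x = \<infinity> \<longleftrightarrow> x \<notin> E" for x
    using c[of x] by (cases "\<Psi> x") (auto simp: extend_def split: if_splits)
  then show "\<Psi> = extend E (Psi_val \<beta>)"
    using assms(1) by (auto simp: base_functions_def extend_def edom_def fun_eq_iff less_top)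
qed

lemma Ck_on_2_Psi_base:
  assumes "(D, E) \<in> base_domains \<beta>"
  shows "Ck_on 2 (fin (extend E (Psi_val \<beta>))) E"
    and "\<And>y. y \<in> E \<Longrightarrow> (fin (extend E (Psi_val \<beta>)) has_real_derivative grad_Psi \<beta> y) (at y)"
proof -
  interpret smooth_convex E "Psi_val \<beta>" "grad_Psi \<beta>"
    using smooth_convex_Psi[OF assms] .
  note E = open_Psi_domain[OF assms]
  show d: "\<And>y. y \<in> E \<Longrightarrow> (fin (extend E (Psi_val \<beta>)) has_real_derivative grad_Psi \<beta> y) (at y)"
    using has_real_derivative_fin_extend E by (simp add: interior_open)
  show "Ck_on 2 (fin (extend E (Psi_val \<beta>))) E"
    by (rule Ck_on_2I[OF E d has_real_derivative_grad_Psi_base(1)[OF assms]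
          continuous_on_variance_function[OF assms]])
qed

lemma legendre_base_pair_extend:
  assumes "(D, E) \<in> base_domains \<beta>"
  shows "legendre_base_pair \<beta> (extend D (Phi_val \<beta>)) (extend E (Psi_val \<beta>))"
proof -
  interpret smooth_convex D "Phi_val \<beta>" "grad_Phi \<beta>"
    using smooth_convex_Phi[OF assms] .
  have "base_functions \<beta> (extend D (Phi_val \<beta>)) (extend E (Psi_val \<beta>))"
    unfolding base_functions_def edom_extend
    using Phi_defined_base[OF assms] Psi_defined_base[OF assms] conjugate_Phi_base[OF assms]
    by (auto simp: extend_def)
  then show ?thesis
    unfolding legendre_base_pair_def
    using legendre_Phi_base[OF assms] legendre_Psi_base[OF assms] Ck_on_1_extend
      Ck_on_2_Psi_base(1)[OF assms] open_Psi_domain[OF assms] by (simp add: interior_open)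
qed

text \<open>
  Since \<open>\<Psi>\<close> is \<open>\<Phi>\<^sup>*\<close> up to a constant, Fenchel's inequality bounds \<open>\<Psi>\<^sup>*\<close> by \<open>\<Phi>\<close> plus a
  constant.  Hence \<open>\<Psi>\<^sup>*\<close> is finite on all of \<open>D\<close>, including an endpoint at which no gradient exists.
\<close>

lemma edom_conjugate_Psi_base:
  assumes "(D, E) \<in> base_domains \<beta>"
  shows "edom (conjugate (extend E (Psi_val \<beta>))) = D"
proof
  show "edom (conjugate (extend E (Psi_val \<beta>))) \<subseteq> D"
    using conjugate_Psi_base_infinite[OF assms] by (force simp: edom_def)
  show "D \<subseteq> edom (conjugate (extend E (Psi_val \<beta>)))"
  proof
    fix y assume y: "y \<in> D"
    define c :: real where "c = (if \<beta> = 0 then -1 else 0)"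
    have "conjugate (extend E (Psi_val \<beta>)) y \<le> ereal (Phi_val \<beta> y + c)"
      unfolding conjugate_def
    proof (rule SUP_least)
      fix x
      have "ereal (y * x) - extend D (Phi_val \<beta>) y \<le> conjugate (extend D (Phi_val \<beta>)) x"
        unfolding conjugate_def by (rule SUP_upper) simp
      then show "ereal (x * y) - extend E (Psi_val \<beta>) x \<le> ereal (Phi_val \<beta> y + c)"
        using y conjugate_Phi_base[OF assms, of x]
        by (cases "x \<in> E") (auto simp: extend_def[of D] extend_def[of E] c_def algebra_simps)
    qed
    then show "y \<in> edom (conjugate (extend E (Psi_val \<beta>)))"
      by (auto simp: edom_def intro: le_less_trans)
  qed
qed

section \<open>The dispersion model\<close>

lemma rpow_measurable: "(\<lambda>x. rpow x r) \<in> borel_measurable borel"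
  unfolding rpow_def by measurable

lemma Phi_val_measurable: "Phi_val \<beta> \<in> borel_measurable borel"
  using rpow_measurable[of \<beta>] unfolding Phi_val_def by measurable

theorem mainTheorem4:
  fixes \<beta> \<sigma>2 :: real
    and \<Phi> \<Psi> :: "real \<Rightarrow> ereal"
    and \<B> :: "real set"
    and \<nu> :: "real measure"
    and p0 p1 :: "real \<Rightarrow> real \<Rightarrow> real"
    and V :: "real \<Rightarrow> real"
  assumes beta: "\<beta> \<in> {0..1} \<or> \<beta> \<in> {1<..2} \<inter> R_even"
    and base: "base_functions \<beta> \<Phi> \<Psi>"
    and Phi: "legendre \<Phi>" "Ck_on 1 (fin \<Phi>) (interior (edom \<Phi>))"
    and Psi: "legendre \<Psi>" "Ck_on 2 (fin \<Psi>) (interior (edom \<Psi>))"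
    and observations: "\<B> \<subseteq> edom \<Phi>" "\<B> \<in> sets \<nu>" "(\<lambda>b. b) \<in> borel_measurable \<nu>"
    and dispersion: "0 < \<sigma>2"
    and p0: "(\<lambda>b. p0 b \<sigma>2) \<in> borel_measurable (restrict_space \<nu> \<B>)"
            "\<And>b. b \<in> \<B> \<Longrightarrow> 0 \<le> p0 b \<sigma>2"
    and V: "V = (\<lambda>\<mu>. rpow \<mu> (2 - \<beta>))"
    and p1: "p1 = (\<lambda>b s. p0 b s * exp (- fin \<Phi> b / s))"
  shows "
    ((edom \<Phi>, edom \<Psi>) \<in> base_domains \<beta> \<and>
        (\<forall>(D, E) \<in> base_domains \<beta>.
           \<exists>\<Phi>' \<Psi>'. legendre_base_pair \<beta> \<Phi>' \<Psi>' \<and> edom \<Phi>' = D \<and> edom \<Psi>' = E)) \<and>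
    (edom \<Psi> = interior (edom \<Psi>) \<and>
        (\<forall>\<theta>\<in>edom \<Psi>.
           rpow_defined (deriv (fin \<Psi>) \<theta>) (2 - \<beta>) \<and>
           deriv (deriv (fin \<Psi>)) \<theta> = V (deriv (fin \<Psi>) \<theta>) \<and>
           V (deriv (fin \<Psi>) \<theta>) \<ge> 0)) \<and>
    (\<forall>\<theta>\<in>edom \<Psi>. (\<integral>\<^sup>+b\<in>\<B>. ennreal (bregman_pdf \<Phi> \<Psi> p0 \<theta> \<sigma>2 b) \<partial>\<nu>) = 1 \<longrightarrow>
          log_concave_pdf \<nu> \<B> (\<lambda>b. p0 b \<sigma>2)
            (\<lambda>b. bregman_beta \<Phi> \<Psi> b \<theta> / ereal \<sigma>2) (bregman_pdf \<Phi> \<Psi> p0 \<theta> \<sigma>2)) \<and>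
    (\<forall>\<theta>\<in>edom \<Psi>. \<forall>b\<in>\<B>. bregman_pdf \<Phi> \<Psi> p0 \<theta> \<sigma>2 b = led_pdf \<Psi> p1 \<theta> \<sigma>2 b) \<and>
    ((\<forall>\<theta>\<in>edom \<Psi>. (\<integral>\<^sup>+b\<in>\<B>. ennreal (bregman_pdf \<Phi> \<Psi> p0 \<theta> \<sigma>2 b) \<partial>\<nu>) = 1) \<longrightarrow>
          regular_led_model 2 \<Psi> \<B> \<nu> \<sigma>2 p1 \<and>
          (\<forall>\<theta>\<in>edom \<Psi>. let P = law \<nu> \<B> (bregman_pdf \<Phi> \<Psi> p0 \<theta> \<sigma>2);
               \<mu> = prob_space.expectation P (\<lambda>b. b) in
             integrable P (\<lambda>b. b) \<and> \<mu> = deriv (fin \<Psi>) \<theta> \<and>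
             integrable P (\<lambda>b. b\<^sup>2) \<and>
             prob_space.variance P (\<lambda>b. b) = \<sigma>2 * rpow \<mu> (2 - \<beta>)))"
proof -
  have Phi_val_eq: "Phi_defined \<beta> x \<and> \<Phi> x = ereal (Phi_val \<beta> x)" if "x \<in> edom \<Phi>" for x
    using base that by (auto simp: base_functions_def)
  obtain E where DE: "(edom \<Phi>, E) \<in> base_domains \<beta>"
    using legendre_Phi_domain[OF beta Phi(1) Phi_val_eq] by blast
  note ext = base_functions_extend[OF base Phi(1) Psi(1) DE]
  interpret \<Phi>: smooth_convex "edom \<Phi>" "Phi_val \<beta>" "grad_Phi \<beta>"
    using smooth_convex_Phi[OF DE] .
  have E: "edom \<Psi> = E" "open E"
    using ext(2) open_Psi_domain[OF DE] by (metis edom_extend, simp)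
  have finPhi: "fin \<Phi> x = Phi_val \<beta> x" if "x \<in> edom \<Phi>" for x
    using Phi_val_eq[OF that] by (simp add: fin_def)
  have finPsi: "\<Psi> y = ereal (fin \<Psi> y)" if "y \<in> E" for y
    using that by (subst (1 2) ext(2)) (simp add: fin_def extend_def)
  have dPsi: "(fin \<Psi> has_real_derivative grad_Psi \<beta> y) (at y)" if "y \<in> E" for y
    using Ck_on_2_Psi_base(2)[OF DE that] ext(2) by simp
  note d2 = has_real_derivative_grad_Psi_base[OF DE]
  have derivPsi: "deriv (fin \<Psi>) y = grad_Psi \<beta> y" if "y \<in> E" for y
    using dPsi[OF that] by (rule DERIV_imp_deriv)
  have deriv2Psi: "deriv (deriv (fin \<Psi>)) y = rpow (grad_Psi \<beta> y) (2 - \<beta>)" if "y \<in> E" for y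
    using deriv_eq_on_open[OF E(2) that derivPsi d2(1)[OF that]] by (intro DERIV_imp_deriv) auto
  have bregman: "bregman_beta \<Phi> \<Psi> b \<theta> = ereal (Phi_val \<beta> b + fin \<Psi> \<theta> - b * \<theta>)"
    if "b \<in> edom \<Phi>" "\<theta> \<in> E" for b \<theta>
    using Phi_val_eq[OF that(1)] finPsi[OF that(2)] by (simp add: bregman_beta_def)
  have pdf: "bregman_pdf \<Phi> \<Psi> p0 \<theta> \<sigma>2 b = exp (- (Phi_val \<beta> b + fin \<Psi> \<theta> - b * \<theta>) / \<sigma>2) * p0 b \<sigma>2"
    if "b \<in> \<B>" "\<theta> \<in> E" for b \<theta>
    using bregman[of b \<theta>] that observations(1) by (simp add: bregman_pdf_def subset_eq)
  have led: "bregman_pdf \<Phi> \<Psi> p0 \<theta> \<sigma>2 b = led_pdf \<Psi> p1 \<theta> \<sigma>2 b" if "b \<in> \<B>" "\<theta> \<in> E" for b \<theta>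
  proof -
    have *: "- (Phi_val \<beta> b + fin \<Psi> \<theta> - b * \<theta>) / \<sigma>2
        = - fin \<Phi> b / \<sigma>2 + (b * \<theta> - fin \<Psi> \<theta>) / \<sigma>2"
      using finPhi[of b] that observations(1) by (simp add: subset_eq diff_divide_distrib add_divide_distrib)
    then show ?thesis
      unfolding pdf[OF that] led_pdf_def p1 * exp_add by simp
  qed
  have sp: "space (restrict_space \<nu> \<B>) = \<B>"
    using sets.sets_into_space[OF observations(2)] by (auto simp: space_restrict_space)
  have [measurable]: "(\<lambda>b. b) \<in> borel_measurable (restrict_space \<nu> \<B>)"
    using observations(3) by (rule measurable_restrict_space1)
  note [measurable] = p0(1)
  have [measurable]: "(\<lambda>b. Phi_val \<beta> b) \<in> borel_measurable (restrict_space \<nu> \<B>)"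
    using measurable_compose[OF _ Phi_val_measurable] by measurable

  have domains: "(edom \<Phi>, edom \<Psi>) \<in> base_domains \<beta> \<and>
      (\<forall>(D, E) \<in> base_domains \<beta>.
         \<exists>\<Phi>' \<Psi>'. legendre_base_pair \<beta> \<Phi>' \<Psi>' \<and> edom \<Phi>' = D \<and> edom \<Psi>' = E)"
    using DE E(1) legendre_base_pair_extend edom_extend by blast

  have variance_function: "edom \<Psi> = interior (edom \<Psi>) \<and>
      (\<forall>\<theta>\<in>edom \<Psi>.
         rpow_defined (deriv (fin \<Psi>) \<theta>) (2 - \<beta>) \<and>
         deriv (deriv (fin \<Psi>)) \<theta> = V (deriv (fin \<Psi>) \<theta>) \<and>
         V (deriv (fin \<Psi>) \<theta>) \<ge> 0)"
    using E derivPsi deriv2Psi d2(2,3) by (simp add: interior_open V)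

  have log_concave: "log_concave_pdf \<nu> \<B> (\<lambda>b. p0 b \<sigma>2)
      (\<lambda>b. bregman_beta \<Phi> \<Psi> b \<theta> / ereal \<sigma>2) (bregman_pdf \<Phi> \<Psi> p0 \<theta> \<sigma>2)"
    if \<theta>: "\<theta> \<in> E" and 1: "(\<integral>\<^sup>+b\<in>\<B>. ennreal (bregman_pdf \<Phi> \<Psi> p0 \<theta> \<sigma>2 b) \<partial>\<nu>) = 1" for \<theta>
  proof -
    have ext_eq: "(\<lambda>b. bregman_beta \<Phi> \<Psi> b \<theta> / ereal \<sigma>2)
        = extend (edom \<Phi>) (\<lambda>b. (Phi_val \<beta> b + fin \<Psi> \<theta> - b * \<theta>) / \<sigma>2)"
    proof
      fix b
      show "bregman_beta \<Phi> \<Psi> b \<theta> / ereal \<sigma>2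
          = extend (edom \<Phi>) (\<lambda>b. (Phi_val \<beta> b + fin \<Psi> \<theta> - b * \<theta>) / \<sigma>2) b"
      proof (cases "b \<in> edom \<Phi>")
        case True
        then show ?thesis
          using bregman[OF True \<theta>] dispersion by (simp add: extend_def)
      next
        case False
        then have "bregman_beta \<Phi> \<Psi> b \<theta> = \<infinity>"
          using finPsi[OF \<theta>] by (simp add: bregman_beta_def edom_def)
        then show ?thesis
          using False dispersion by (simp add: extend_def divide_ereal_def)
      qed
    qed
    have "legendre (extend (edom \<Phi>) (Phi_val \<beta>))"
      using Phi(1) ext(1) by simp
    then have leg: "legendre (\<lambda>b. bregman_beta \<Phi> \<Psi> b \<theta> / ereal \<sigma>2)"
      unfolding ext_eq by (rule \<Phi>.legendre_extend_tilt[OF _ dispersion])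
    have "(\<lambda>b. exp (- (Phi_val \<beta> b + fin \<Psi> \<theta> - b * \<theta>) / \<sigma>2) * p0 b \<sigma>2)
        \<in> borel_measurable (restrict_space \<nu> \<B>)"
      by measurable
    then have "bregman_pdf \<Phi> \<Psi> p0 \<theta> \<sigma>2 \<in> borel_measurable (restrict_space \<nu> \<B>)"
      by (rule measurable_cong[THEN iffD2, rotated]) (simp add: sp pdf \<theta>)
    then have "is_pdf \<nu> \<B> (bregman_pdf \<Phi> \<Psi> p0 \<theta> \<sigma>2)"
      using 1 pdf \<theta> p0(2) by (simp add: is_pdf_def)
    moreover have "fin (\<lambda>b. bregman_beta \<Phi> \<Psi> b \<theta> / ereal \<sigma>2) b
        = (Phi_val \<beta> b + fin \<Psi> \<theta> - b * \<theta>) / \<sigma>2" if "b \<in> \<B>" for b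
      unfolding ext_eq using that observations(1) by (intro fin_extend) auto
    ultimately show ?thesis
      unfolding log_concave_pdf_def
      using leg observations(1) pdf \<theta> 
      by (simp add: ext_eq diff_divide_distrib add_divide_distrib)
  qed

  have dispersion_model: "regular_led_model 2 \<Psi> \<B> \<nu> \<sigma>2 p1 \<and>
      (\<forall>\<theta>\<in>edom \<Psi>. let P = law \<nu> \<B> (bregman_pdf \<Phi> \<Psi> p0 \<theta> \<sigma>2);
           \<mu> = prob_space.expectation P (\<lambda>b. b) in
         integrable P (\<lambda>b. b) \<and> \<mu> = deriv (fin \<Psi>) \<theta> \<and>
         integrable P (\<lambda>b. b\<^sup>2) \<and>
         prob_space.variance P (\<lambda>b. b) = \<sigma>2 * rpow \<mu> (2 - \<beta>))"
    if 1: "\<forall>\<theta>\<in>edom \<Psi>. (\<integral>\<^sup>+b\<in>\<B>. ennreal (bregman_pdf \<Phi> \<Psi> p0 \<theta> \<sigma>2 b) \<partial>\<nu>) = 1"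
  proof -
    define h where "h b = p0 b \<sigma>2 * exp (- Phi_val \<beta> b / \<sigma>2)" for b
    have h_eq: "h b = p1 b \<sigma>2" if "b \<in> \<B>" for b
      using finPhi[of b] that observations(1) by (auto simp: h_def p1)
    interpret fam: exponential_family \<nu> \<B> E h "fin \<Psi>" "grad_Psi \<beta>"
        "\<lambda>\<theta>. rpow (grad_Psi \<beta> \<theta>) (2 - \<beta>)" \<sigma>2
    proof
      show "h \<in> borel_measurable (restrict_space \<nu> \<B>)"
        unfolding h_def[abs_def] by measurable
      fix \<theta> assume \<theta>: "\<theta> \<in> E"
      have "(\<integral>\<^sup>+b\<in>\<B>. ennreal (h b * exp ((b * \<theta> - fin \<Psi> \<theta>) / \<sigma>2)) \<partial>\<nu>)
          = (\<integral>\<^sup>+b\<in>\<B>. ennreal (bregman_pdf \<Phi> \<Psi> p0 \<theta> \<sigma>2 b) \<partial>\<nu>)"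
        using led \<theta> h_eq
        by (intro nn_integral_cong) (auto simp: led_pdf_def indicator_def)
      then show "(\<integral>\<^sup>+b\<in>\<B>. ennreal (h b * exp ((b * \<theta> - fin \<Psi> \<theta>) / \<sigma>2)) \<partial>\<nu>) = 1"
        using 1 \<theta> E(1) by simp
    qed (use observations(2,3) E(2) dispersion p0(2) dPsi d2(1) in \<open>auto simp: h_def\<close>)
    have dens_led: "fam.dens \<theta> b = led_pdf \<Psi> p1 \<theta> \<sigma>2 b" if "b \<in> \<B>" for \<theta> b
      using h_eq[OF that] by (simp add: fam.dens_def led_pdf_def)
    have pdf_cong: "is_pdf \<nu> \<B> f \<longleftrightarrow> is_pdf \<nu> \<B> g" if "\<And>b. b \<in> \<B> \<Longrightarrow> f b = g b" for f g
    proof -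
      have "f \<in> borel_measurable (restrict_space \<nu> \<B>) \<longleftrightarrow> g \<in> borel_measurable (restrict_space \<nu> \<B>)"
        using that by (intro measurable_cong) (simp add: sp)
      moreover have "(\<integral>\<^sup>+b\<in>\<B>. ennreal (f b) \<partial>\<nu>) = (\<integral>\<^sup>+b\<in>\<B>. ennreal (g b) \<partial>\<nu>)"
        using that by (intro nn_integral_cong) (simp add: indicator_def)
      ultimately show ?thesis
        using that by (simp add: is_pdf_def)
    qed
    have law_cong: "law \<nu> \<B> f = law \<nu> \<B> (fam.dens \<theta>)" if "\<And>b. b \<in> \<B> \<Longrightarrow> f b = fam.dens \<theta> b" for f \<theta>
    proof -
      have "f \<in> borel_measurable (restrict_space \<nu> \<B>)"
        using that fam.dens_measurable[of \<theta>] measurable_cong[of "restrict_space \<nu> \<B>" f "fam.dens \<theta>"]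
        by (simp add: sp)
      then show ?thesis
        unfolding law_def using that by (intro density_cong) (auto simp: sp)
    qed
    have law_led: "law \<nu> \<B> (led_pdf \<Psi> p1 \<theta> \<sigma>2) = law \<nu> \<B> (fam.dens \<theta>)" for \<theta>
      by (rule law_cong) (simp add: dens_led)
    have law_bregman: "law \<nu> \<B> (bregman_pdf \<Phi> \<Psi> p0 \<theta> \<sigma>2) = law \<nu> \<B> (fam.dens \<theta>)" if "\<theta> \<in> E" for \<theta>
      by (rule law_cong) (simp add: dens_led led that)

    have edom_conj: "edom (conjugate \<Psi>) = edom \<Phi>"
      using edom_conjugate_Psi_base[OF DE] ext(2) by simp
    (* The means fill the interior of the domain, and taking closures also reaches the endpoints, so
       that the hull of the observations agrees with the domain up to endpoints. *)
    have "interior (edom \<Phi>) \<subseteq> convex hull \<B>"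
      unfolding grad_Psi_image[OF DE, symmetric] using fam.mean_in_convex_hull by auto
    then have "closure (interior (edom \<Phi>)) \<subseteq> closure (convex hull \<B>)"
      by (rule closure_mono)
    then have clD: "closure (edom \<Phi>) \<subseteq> closure (convex hull \<B>)"
      using convex_closure_interior[OF \<Phi>.convex \<Phi>.interior_nonempty] by simp
    have "convex hull \<B> \<subseteq> edom \<Phi>"
      using observations(1) \<Phi>.convex by (rule hull_minimal)
    then have "closure (convex hull \<B>) = closure (edom \<Phi>)"
      using clD closure_mono by blast
    then have int: "interior (edom (conjugate \<Psi>)) = interior (closure (convex hull \<B>))"
      by (simp add: edom_conj convex_interior_closure[OF \<Phi>.convex])
    have sub: "edom (conjugate \<Psi>) \<subseteq> closure (convex hull \<B>)"
      using clD closure_subset[of "edom \<Phi>"] by (auto simp: edom_conj)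

    have cumulants: "let P = law \<nu> \<B> (led_pdf \<Psi> p1 \<theta> \<sigma>2) in
        integrable P (\<lambda>b. b) \<and>
        prob_space.expectation P (\<lambda>b. b) = deriv (fin \<Psi>) \<theta> \<and>
        (\<forall>\<^sub>F x in nhds 0. integrable P (\<lambda>b. exp (x * b))) \<and>
        (\<forall>j\<in>{1..2}. (deriv ^^ j) (cgf P) 0 =
           (deriv ^^ j) (\<lambda>x. (fin \<Psi> (\<theta> + x * \<sigma>2) - fin \<Psi> \<theta>) / \<sigma>2) 0)" if \<theta>: "\<theta> \<in> E" for \<theta>
      using fam.moments(1,2)[OF \<theta>] derivPsi[OF \<theta>] fam.cgf_eventually[OF \<theta>]
      unfolding Let_def law_led
      by (auto intro!: higher_deriv_cong_ev elim: eventually_mono)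
    have "led_model 2 \<Psi> \<B> \<nu> \<sigma>2 p1"
      unfolding led_model_def
      using dispersion Psi int sub observations(1) edom_conj cumulants E
        pdf_cong[OF dens_led] fam.is_pdf_dens by (simp add: interior_open)
    then have "regular_led_model 2 \<Psi> \<B> \<nu> \<sigma>2 p1"
      using E by (simp add: regular_led_model_def)
    then show ?thesis
      using fam.moments(1-3) fam.variance law_bregman derivPsi by (simp add: E(1) Let_def)
  qed

  show ?thesis
    using domains variance_function log_concave led dispersion_model E(1) by blast
qed

end
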